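(* Let $(\mathbb S,+,\cdot,0,1)$ be a commutative semiring. The weighted tree languages over $\mathbb S$ generated by eq-restricted positive classic weighted tree grammars with constraints (WTGc) are closed under relabelings. That is, if $A\in\mathbb S^{T_\Sigma}$ is generated by an eq-restricted positive classic WTGc and $\pi\in\Delta^\Sigma$ is a relabeling, then $\pi(A)\in\mathbb S^{T_\Delta}$, given by $\pi(A)_u=\sum_{t\in\pi^{-1}(u)}A_t$ for all $u\in T_\Delta$, is generated by an eq-restricted positive classic WTGc.
   Context: Trees: $\mathbb N=\{0,1,2,\dots\}$, $[k]=\{1,\dots,k\}$. A ranked alphabet $\Sigma$ is a finite set with a rank map $\mathrm{rk}\colon\Sigma\to\mathbb N$; $\Sigma_k=\mathrm{rk}^{-1}(k)$. $T_\Sigma(Z)$ is the smallest set containing $Z$ (disjoint from $\Sigma$) and $\sigma(t_1,\dots,t_k)$ for all $\sigma\in\Sigma_k$, $t_1,\dots,t_k\in T_\Sigma(Z)$; $T_\Sigma=T_\Sigma(\emptyset)$. Positions: $\mathrm{pos}(z)=\{\varepsilon\}$ for $z \in Z$ and $\mathrm{pos}(\sigma(t_1,\dots,t_k))=\{\varepsilon\}\cup\{iw\mid i\in[k],w\in\mathrm{pos}(t_i)\}$. $t(w)$, $t|_w$, $t[t']_w$ denote the label at $w$, the subtree at $w$, and the replacement of the subtree at $w$ by $t'$. $\mathrm{pos}_S(t)=\{w\in\mathrm{pos}(t)\mid t(w)\in S\}$. $X_k=\{x_1,\dots,x_k\}$ are variables; $c[t_1,\dots,t_k]$ is substitution of $t_i$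 for $x_i$. $\widehat C_\Sigma(X_k)$ is the set of $c\in T_\Sigma(X_k)$ in which each of $x_1,\dots,x_k$ occurs exactly once and in the order $x_1\cdots x_k$ from left to right. Relabeling: a map $\pi\colon\Sigma\to\Delta$ between ranked alphabets with $\pi_\sigma\in\Delta_k$ for every $k$ and $\sigma\in\Sigma_k$; it extends to $\pi\colon T_\Sigma\to T_\Delta$ by $\pi(\sigma(t_1,\dots,t_k))=\pi_\sigma(\pi(t_1),\dots,\pi(t_k))$. Each $\pi^{-1}(u)$ is finite. Commutative semiring: $(\mathbb S,+,0)$ and $(\mathbb S,\cdot,1)$ are commutative monoids, $\cdot$ distributes over $+$, and $0\cdot s=0$. A weighted tree language over $\mathbb S$ is a map $A\colon T_\Sigma\to\mathbb S$, $t\mapsto A_t$. A WTGc over $\mathbb S$ is a tuple $G=(Q,\Sigma,F,P,\mathrm{wt})$ with a finite set $Q$ of nonterminals, final weights $F\in\mathbb S^Q$, a ranked alphabet $\Sigma$, a finite set $P$ of productions $(\ell,q,E,I)$, written $\ell\xrightarrow{E,I}q$, where $\ell\in T_\Sigma(Q)\setminus Q$, $q\in Q$, and $E,I\subseteq\mathbb N^*\times\mathbb N^*$ are finite (equality and inequality constraints), and $\mathrm{wt}\in\mathbb S^P$. A tree $t\in T_\Sigma$ satisfies $(v,v')$ if $v,v'\in\mathrm{pos}(t)$ and $t|_v=t|_{v'}$, otherwise it dissatisfies it. For $\xi,\zeta\in T_\Sigma(Q)$, $\xi\Rightarrow^{p,w}_{G,t}\zeta$ holds for $p=\ell\xrightarrow{E,I}q$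 and $w\in\mathrm{pos}(\xi)$ if $\xi|_w=\ell$, $\zeta=\xi[q]_w$, $t|_w$ satisfies all pairs in $E$ and dissatisfies all pairs in $I$. $D^q_G(t)$ is the set of complete left-most derivations for $t$ to $q$, i.e. sequences $d=(p_1,w_1)\cdots(p_n,w_n)$ with $t\Rightarrow^{p_1,w_1}_{G,t}\xi_1\Rightarrow\cdots\Rightarrow^{p_n,w_n}_{G,t}\xi_n=q$ and $w_1\prec\cdots\prec w_n$, where $\preceq$ is the lexicographic order on $\mathbb N^*$ in which prefixes are larger (so $\varepsilon$ is largest). $\mathrm{wt}_G(d)=\prod_i\mathrm{wt}(p_i)$. $G$ generates the weighted tree language $G_t=\sum_{q\in Q,\,d\in D_G^q(t)}F_q\cdot\mathrm{wt}_G(d)$. A production $\ell\xrightarrow{E,I}q$ is positive if $I=\emptyset$ and classic if $v,v'\in\mathrm{pos}_Q(\ell)$ for all $(v,v')\in E\cup I$. A WTGc is positive/classic if all its productions are. Eq-restricted: a nonterminal $\bot$ is a sink nonterminal if $F_\bot=0$ and the productions with target $\bot$ are exactly $\sigma(\bot,\dots,\bot)\to\bot$ (without constraints, weight $1$) for all $\sigma\in\Sigma$. Each production is uniquely written $c[q_1,\dots,q_k]\xrightarrow{E,I}q$ with $c\in\widehat C_\Sigma(X_k)$, $q_i\in Q$; let $c(E)=\{(i,j)\in[k]^2\mid (v,v')\in E,\ c(v)=x_i,\ c(v')=x_j\}$ and $\equiv_{c(E)}$ be the smallest equivalence relation on $[k]$ containing it. A classic WTGc is eq-restricted if there is a sink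 nonterminal $\bot\in Q$ such that for every production $c[q_1,\dots,q_k]\xrightarrow{E,I}q$ and every $i\in[k]$ there is $q'\in Q$ with (1) $\{q_j\mid j\in[i]_{\equiv_{c(E)}}\}\subseteq\{q',\bot\}$ and (2) exactly one $j\in[i]_{\equiv_{c(E)}}$ has $q_j=q'$. *)

theory Defs
  imports Main
begin

section \<open>Trees over ranked alphabets\<close>

record 'f ranked_alphabet =
  symbols :: "'f set"
  rk :: "'f \<Rightarrow> nat"

definition ranked_alphabet :: "'f ranked_alphabet \<Rightarrow> bool" where
  "ranked_alphabet \<Sigma> \<longleftrightarrow> finite (symbols \<Sigma>)"

datatype ('f, 'z) tree = Leaf 'z | Node 'f "('f, 'z) tree list"

inductive_set trees :: "'f ranked_alphabet \<Rightarrow> 'z set \<Rightarrow> ('f, 'z) tree set"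
  for \<Sigma> :: "'f ranked_alphabet" and Z :: "'z set" where
  Leaf: "z \<in> Z \<Longrightarrow> Leaf z \<in> trees \<Sigma> Z"
| Node: "\<lbrakk>\<sigma> \<in> symbols \<Sigma>; length ts = rk \<Sigma> \<sigma>; \<And>t. t \<in> set ts \<Longrightarrow> t \<in> trees \<Sigma> Z\<rbrakk>
    \<Longrightarrow> Node \<sigma> ts \<in> trees \<Sigma> Z"

text \<open>
  Ground trees have a type of their own, so that the type of a weighted tree language does not
  mention the nonterminals of a grammar generating it. The embedding \<open>emb\<close> identifies
  \<open>gtrees \<Sigma>\<close> with \<open>trees \<Sigma> {}\<close>, see \<open>emb_gtrees\<close> below. The map function of the datatype is the
  extension of a relabeling to trees.
\<close>

datatype 'f gtree = GNode 'f "'f gtree list"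
  for map: relabel

inductive_set gtrees :: "'f ranked_alphabet \<Rightarrow> 'f gtree set"
  for \<Sigma> :: "'f ranked_alphabet" where
  GNode: "\<lbrakk>\<sigma> \<in> symbols \<Sigma>; length ts = rk \<Sigma> \<sigma>; \<And>t. t \<in> set ts \<Longrightarrow> t \<in> gtrees \<Sigma>\<rbrakk>
    \<Longrightarrow> GNode \<sigma> ts \<in> gtrees \<Sigma>"

primrec emb :: "'f gtree \<Rightarrow> ('f, 'z) tree" where
  "emb (GNode \<sigma> ts) = Node \<sigma> (map emb ts)"

lemma emb_inject: "(emb t :: ('f, 'z) tree) = emb t' \<longleftrightarrow> t = t'"
proof (induction t arbitrary: t')
  case (GNode \<sigma> ts)
  obtain \<sigma>' ts' where t': "t' = GNode \<sigma>' ts'" by (cases t')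
  have "(map emb ts :: ('f, 'z) tree list) = map emb ts' \<longleftrightarrow> ts = ts'"
    using GNode.IH
  proof (induction ts arbitrary: ts')
    case (Cons a ts)
    then show ?case by (cases ts') auto
  qed auto
  then show ?case by (simp add: t')
qed

lemma emb_gtrees: "emb ` gtrees \<Sigma> = trees \<Sigma> {}"
proof (intro equalityI subsetI)
  fix s :: "('a, 'b) tree"
  assume "s \<in> emb ` gtrees \<Sigma>"
  then obtain t where s: "s = emb t" and "t \<in> gtrees \<Sigma>" by blast
  from this(2) have "emb t \<in> trees \<Sigma> ({} :: 'b set)"
    by induction (auto intro!: trees.Node)
  then show "s \<in> trees \<Sigma> {}" by (simp add: s)
next
  fix s :: "('a, 'b) tree"
  assume "s \<in> trees \<Sigma> {}"
  then show "s \<in> emb ` gtrees \<Sigma>"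
  proof induction
    case (Node \<sigma> ts)
    have "\<forall>t\<in>set ts. \<exists>g. t = emb g \<and> g \<in> gtrees \<Sigma>"
      using Node.IH by blast
    then obtain g where g: "\<forall>t\<in>set ts. t = emb (g t) \<and> g t \<in> gtrees \<Sigma>"
      by (rule bchoice[THEN exE])
    have "Node \<sigma> ts = emb (GNode \<sigma> (map g ts))"
      using g by (auto intro!: map_idI[symmetric])
    moreover have "GNode \<sigma> (map g ts) \<in> gtrees \<Sigma>"
      using g Node by (auto intro!: gtrees.GNode)
    ultimately show ?case by blast
  qed auto
qed

text \<open>
  Positions are 1-based. Outside \<open>pos t\<close> the values of \<open>subtree\<close>, \<open>replace\<close> and \<open>label\<close> carry no meaning.
\<close>

type_synonym position = "nat list"

lemma size_nth_less [termination_simp]: "i < length ts \<Longrightarrow> size (ts ! i) < Suc (size_list size ts)"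
  by (simp add: less_Suc_eq_le size_list_estimation'[OF nth_mem])

fun pos :: "('f, 'z) tree \<Rightarrow> position set" where
  "pos (Leaf z) = {[]}"
| "pos (Node \<sigma> ts) = {[]} \<union> (\<Union>i<length ts. {Suc i # w | w. w \<in> pos (ts ! i)})"

fun subtree :: "('f, 'z) tree \<Rightarrow> position \<Rightarrow> ('f, 'z) tree" where
  "subtree t [] = t"
| "subtree (Node \<sigma> ts) (i # w) = subtree (ts ! (i - 1)) w"
| "subtree (Leaf z) (i # w) = undefined"

fun replace :: "('f, 'z) tree \<Rightarrow> position \<Rightarrow> ('f, 'z) tree \<Rightarrow> ('f, 'z) tree" where
  "replace t [] t' = t'"
| "replace (Node \<sigma> ts) (i # w) t' = Node \<sigma> (ts[i - 1 := replace (ts ! (i - 1)) w t'])"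
| "replace (Leaf z) (i # w) t' = undefined"

definition label :: "('f, 'z) tree \<Rightarrow> position \<Rightarrow> 'f + 'z" where
  "label t w = (case subtree t w of Leaf z \<Rightarrow> Inr z | Node \<sigma> ts \<Rightarrow> Inl \<sigma>)"

definition pos_labelled :: "('f + 'z) set \<Rightarrow> ('f, 'z) tree \<Rightarrow> position set" where
  "pos_labelled S t = {w \<in> pos t. label t w \<in> S}"

text \<open>Lexicographic order in which a proper prefix of a position is larger than the position.\<close>

fun pos_less :: "position \<Rightarrow> position \<Rightarrow> bool" where
  "pos_less [] w = False"
| "pos_less (i # v) [] = True"
| "pos_less (i # v) (j # w) \<longleftrightarrow> i < j \<or> i = j \<and> pos_less v w"

text \<open>The variable \<open>x\<^sub>i\<close> is represented by \<open>Leaf i\<close>.\<close>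

primrec subst :: "('f, nat) tree \<Rightarrow> ('f, 'z) tree list \<Rightarrow> ('f, 'z) tree" where
  "subst (Leaf i) us = us ! (i - 1)"
| "subst (Node \<sigma> ts) us = Node \<sigma> (map (\<lambda>t. subst t us) ts)"

primrec frontier :: "('f, 'z) tree \<Rightarrow> 'z list" where
  "frontier (Leaf z) = [z]"
| "frontier (Node \<sigma> ts) = concat (map frontier ts)"

definition contexts :: "'f ranked_alphabet \<Rightarrow> nat \<Rightarrow> ('f, nat) tree set" where
  "contexts \<Sigma> k = {c \<in> trees \<Sigma> {1..k}. frontier c = [1..<k + 1]}"

section \<open>Relabelings\<close>

definition relabeling :: "'f ranked_alphabet \<Rightarrow> 'g ranked_alphabet \<Rightarrow> ('f \<Rightarrow> 'g) \<Rightarrow> bool" where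
  "relabeling \<Sigma> \<Delta> \<pi> \<longleftrightarrow> (\<forall>\<sigma>\<in>symbols \<Sigma>. \<pi> \<sigma> \<in> symbols \<Delta> \<and> rk \<Delta> (\<pi> \<sigma>) = rk \<Sigma> \<sigma>)"

text \<open>
  The sort \<open>{comm_semiring_0, comm_monoid_mult}\<close> is that of commutative semirings;
  \<open>comm_semiring_1\<close> would in addition require \<open>0 \<noteq> 1\<close>.
\<close>

definition relabel_language ::
  "'f ranked_alphabet \<Rightarrow> ('f \<Rightarrow> 'g) \<Rightarrow> ('f gtree \<Rightarrow> 's::{comm_semiring_0, comm_monoid_mult}) \<Rightarrow> 'g gtree \<Rightarrow> 's" where
  "relabel_language \<Sigma> \<pi> A u = (\<Sum>t | t \<in> gtrees \<Sigma> \<and> relabel \<pi> t = u. A t)"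

section \<open>Weighted tree grammars with constraints\<close>

type_synonym constraints = "(position \<times> position) set"

text \<open>\<open>(l, q, E, I)\<close> stands for the production from \<open>l\<close> to \<open>q\<close>.\<close>

type_synonym ('f, 'q) production = "('f, 'q) tree \<times> 'q \<times> constraints \<times> constraints"

record ('q, 'f, 's) wtgc =
  nonterminals :: "'q set"
  alphabet :: "'f ranked_alphabet"
  final_weight :: "'q \<Rightarrow> 's"
  productions :: "('f, 'q) production set"
  wt :: "('f, 'q) production \<Rightarrow> 's"

definition wtgc :: "('q, 'f, 's) wtgc \<Rightarrow> bool" where
  "wtgc G \<longleftrightarrow> finite (nonterminals G) \<and> ranked_alphabet (alphabet G) \<and> finite (productions G) \<and>
    (\<forall>(l, q, E, I)\<in>productions G.
      l \<in> trees (alphabet G) (nonterminals G) - Leaf ` nonterminals G \<and>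
      q \<in> nonterminals G \<and> finite E \<and> finite I)"

definition satisfies :: "('f, 'z) tree \<Rightarrow> position \<times> position \<Rightarrow> bool" where
  "satisfies t = (\<lambda>(v, v'). v \<in> pos t \<and> v' \<in> pos t \<and> subtree t v = subtree t v')"

definition step ::
  "('q, 'f, 's) wtgc \<Rightarrow> ('f, 'q) tree \<Rightarrow> ('f, 'q) production \<Rightarrow> position \<Rightarrow> ('f, 'q) tree \<Rightarrow> ('f, 'q) tree \<Rightarrow> bool" where
  "step G t p w \<xi> \<zeta> \<longleftrightarrow> p \<in> productions G \<and> w \<in> pos \<xi> \<and>
    (case p of (l, q, E, I) \<Rightarrow>
      subtree \<xi> w = l \<and> \<zeta> = replace \<xi> w (Leaf q) \<and>
      (\<forall>e\<in>E. satisfies (subtree t w) e) \<and> (\<forall>e\<in>I. \<not> satisfies (subtree t w) e))"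

primrec steps ::
  "('q, 'f, 's) wtgc \<Rightarrow> ('f, 'q) tree \<Rightarrow> (('f, 'q) production \<times> position) list \<Rightarrow> ('f, 'q) tree \<Rightarrow> ('f, 'q) tree \<Rightarrow> bool" where
  "steps G t [] \<xi> \<zeta> \<longleftrightarrow> \<xi> = \<zeta>"
| "steps G t (pw # d) \<xi> \<zeta> \<longleftrightarrow> (\<exists>\<xi>'. step G t (fst pw) (snd pw) \<xi> \<xi>' \<and> steps G t d \<xi>' \<zeta>)"

definition derivations ::
  "('q, 'f, 's) wtgc \<Rightarrow> 'q \<Rightarrow> 'f gtree \<Rightarrow> (('f, 'q) production \<times> position) list set" where
  "derivations G q t = {d. steps G (emb t) d (emb t) (Leaf q) \<and> sorted_wrt pos_less (map snd d)}"

definition wt_derivation ::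
  "('q, 'f, 's::{comm_semiring_0, comm_monoid_mult}) wtgc \<Rightarrow> (('f, 'q) production \<times> position) list \<Rightarrow> 's" where
  "wt_derivation G d = prod_list (map (\<lambda>(p, w). wt G p) d)"

text \<open>
  The index set of the sum is finite for every \<open>wtgc\<close>: the positions of a derivation are strictly
  increasing and belong to \<open>t\<close>.
\<close>

definition generated ::
  "('q, 'f, 's::{comm_semiring_0, comm_monoid_mult}) wtgc \<Rightarrow> 'f gtree \<Rightarrow> 's" where
  "generated G t =
    (\<Sum>(q, d)\<in>Sigma (nonterminals G) (\<lambda>q. derivations G q t). final_weight G q * wt_derivation G d)"

definition generates ::
  "('q, 'f, 's::{comm_semiring_0, comm_monoid_mult}) wtgc \<Rightarrow> ('f gtree \<Rightarrow> 's) \<Rightarrow> bool" where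
  "generates G A \<longleftrightarrow> (\<forall>t\<in>gtrees (alphabet G). A t = generated G t)"

definition positive :: "('q, 'f, 's) wtgc \<Rightarrow> bool" where
  "positive G \<longleftrightarrow> (\<forall>(l, q, E, I)\<in>productions G. I = {})"

definition classic :: "('q, 'f, 's) wtgc \<Rightarrow> bool" where
  "classic G \<longleftrightarrow> (\<forall>(l, q, E, I)\<in>productions G. \<forall>(v, v')\<in>E \<union> I.
    v \<in> pos_labelled (Inr ` nonterminals G) l \<and> v' \<in> pos_labelled (Inr ` nonterminals G) l)"

definition sink :: "('q, 'f, 's::{comm_semiring_0, comm_monoid_mult}) wtgc \<Rightarrow> 'q \<Rightarrow> bool" where
  "sink G b \<longleftrightarrow> b \<in> nonterminals G \<and> final_weight G b = 0 \<and>
    {(l, q, E, I) \<in> productions G. q = b} =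
      (\<lambda>\<sigma>. (Node \<sigma> (replicate (rk (alphabet G) \<sigma>) (Leaf b)), b, {}, {})) ` symbols (alphabet G) \<and>
    (\<forall>(l, q, E, I)\<in>productions G. q = b \<longrightarrow> wt G (l, q, E, I) = 1)"

definition var_pairs :: "('f, nat) tree \<Rightarrow> nat \<Rightarrow> constraints \<Rightarrow> (nat \<times> nat) set" where
  "var_pairs c k E = {(i, j). i \<in> {1..k} \<and> j \<in> {1..k} \<and>
    (\<exists>(v, v')\<in>E. v \<in> pos_labelled {Inr i} c \<and> v' \<in> pos_labelled {Inr j} c)}"

definition equiv_hull :: "nat \<Rightarrow> (nat \<times> nat) set \<Rightarrow> (nat \<times> nat) set" where
  "equiv_hull k r = \<Inter> {R. equiv {1..k} R \<and> r \<subseteq> R}"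

text \<open>
  The left-hand side of a production determines \<open>k\<close>, \<open>c\<close> and \<open>qs\<close> uniquely, so the quantifier over
  them ranges over exactly one decomposition, with \<open>q\<^sub>j = qs ! (j - 1)\<close>.
\<close>

definition eq_restricted :: "('q, 'f, 's::{comm_semiring_0, comm_monoid_mult}) wtgc \<Rightarrow> bool" where
  "eq_restricted G \<longleftrightarrow> classic G \<and> (\<exists>b. sink G b \<and>
    (\<forall>(l, q, E, I)\<in>productions G. \<forall>k c qs.
      c \<in> contexts (alphabet G) k \<and> length qs = k \<and> set qs \<subseteq> nonterminals G \<and>
      l = subst c (map Leaf qs) \<longrightarrow>
      (\<forall>i\<in>{1..k}. \<exists>q'\<in>nonterminals G.
        (let J = equiv_hull k (var_pairs c k E) `` {i} in
          {qs ! (j - 1) | j. j \<in> J} \<subseteq> {q', b} \<and>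
          (\<exists>!j. j \<in> J \<and> qs ! (j - 1) = q')))))"

end

theory Submission
  imports Defs "HOL-Library.FuncSet"
begin

text \<open>
  Let \<open>W q t\<close> be the sum of the weights of all derivations of \<open>t\<close> to \<open>q\<close>. A derivation ending with
  a production with left-hand side \<open>c[q\<^sub>1,\<dots>,q\<^sub>k]\<close> splits uniquely into derivations of the
  subtrees \<open>t\<^sub>i\<close> to \<open>q\<^sub>i\<close>, so \<open>W q t\<close> is a sum over productions of products of the \<open>W q\<^sub>i t\<^sub>i\<close>.
  Summing over all preimages \<open>t\<close> of \<open>u\<close>, the tuples \<open>(t\<^sub>1,\<dots>,t\<^sub>k)\<close> range over those that are constant
  on the constraint classes. In each class all but one factor belong to the sink and equal 1, so
  the sum factors into sums over the preimages of one representative per class, and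
  relabeling the productions while adding up the weights of identified ones works.

  The only obstacle is the sink as a representative (of a singleton class): it has to contribute the
  number of preimages. Therefore the old sink is kept as an ordinary nonterminal there, and a
  fresh sink \<open>0\<close> takes over the remaining positions.
\<close>

section \<open>Sums over functions that are constant on classes\<close>

text \<open>What makes the factorisation possible is eq-restriction. Two weighted leaves in one
  class would give a diagonal sum of products over the common subtree, which is not a product of two
  separate sums. The relabeled production only tests whether the subtrees of \<open>u\<close> agree,
  although their preimages could differ; leaving all the weight of a class on one member makes it
  count one common choice per class.

  A sink has weight 1 on every tree, whereas relabeling merges the productions of the old sink, adds
  up their weights and may miss symbols of \<Delta>. The relabeled old sink is thus in general no
  sink any more, which forces the two copies. The invariant of the induction on \<open>u\<close>
  reads W' (h q) u = (sum of W q g over the preimages g of u) for the images of old nonterminals,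
  while the fresh sink is constantly 1.

  Constraints are tested on the input tree and not on the sentential form; this is why derivations
  of different subtrees are independent. Since the grammar is classic, the constrained positions are
  leaves of the left-hand side, and relabeling does not move them.\<close>

lemma prod_sum_PiE_semiring:
  fixes w :: "'a \<Rightarrow> 'b \<Rightarrow> 's::{comm_semiring_0, comm_monoid_mult}"
  assumes "finite A" "\<And>x. x \<in> A \<Longrightarrow> finite (B x)"
  shows "(\<Sum>f\<in>PiE A B. \<Prod>x\<in>A. w x (f x)) = (\<Prod>x\<in>A. \<Sum>y\<in>B x. w x y)"
  using assms
proof (induction A rule: finite_induct)
  case empty
  then show ?case by simp
next
  case (insert x A)
  have fin: "finite (PiE A B)" using insert by (simp add: finite_PiE)
  have "(\<Sum>f\<in>PiE (insert x A) B. \<Prod>z\<in>insert x A. w z (f z))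
      = (\<Sum>(y, f)\<in>B x \<times> PiE A B. \<Prod>z\<in>insert x A. w z ((f(x := y)) z))"
    unfolding PiE_insert_eq using insert.hyps
    by (subst sum.reindex[OF inj_combinator]) (auto intro!: sum.cong)
  also have "\<dots> = (\<Sum>(y, f)\<in>B x \<times> PiE A B. w x y * (\<Prod>z\<in>A. w z (f z)))"
  proof (intro sum.cong refl, clarify)
    fix y f
    have "(\<Prod>z\<in>A. w z ((f(x := y)) z)) = (\<Prod>z\<in>A. w z (f z))"
      using insert.hyps by (intro prod.cong) auto
    then show "(\<Prod>z\<in>insert x A. w z ((f(x := y)) z)) = w x y * (\<Prod>z\<in>A. w z (f z))"
      using insert.hyps by simp
  qed
  also have "\<dots> = (\<Sum>y\<in>B x. w x y) * (\<Sum>f\<in>PiE A B. \<Prod>z\<in>A. w z (f z))"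
    unfolding sum.cartesian_product[symmetric] sum_distrib_left[symmetric] sum_distrib_right[symmetric] ..
  also have "\<dots> = (\<Prod>z\<in>insert x A. \<Sum>y\<in>B z. w z y)"
    using insert by simp
  finally show ?case .
qed

text \<open>Restriction to the transversal \<open>T\<close> is a bijection of the index sets: a
  function constant on the classes is determined by its values on \<open>T\<close>, and every
  function on \<open>T\<close> extends along the representatives. The factors outside
  \<open>T\<close> are 1, so the product survives the restriction, and distributivity
  finishes.\<close>

lemma sum_constant_on_classes:
  fixes w :: "'a \<Rightarrow> 'b \<Rightarrow> 's::{comm_semiring_0, comm_monoid_mult}"
  assumes X: "finite X" and R: "equiv X R" and TX: "T \<subseteq> X"
    and T: "\<And>x. x \<in> X \<Longrightarrow> \<exists>!y. y \<in> T \<and> (x, y) \<in> R"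
    and B: "\<And>x. x \<in> X \<Longrightarrow> finite (B x)" "\<And>x y. (x, y) \<in> R \<Longrightarrow> B x = B y"
    and w: "\<And>x a. x \<in> X - T \<Longrightarrow> a \<in> B x \<Longrightarrow> w x a = 1"
  shows "(\<Sum>f\<in>{f \<in> PiE X B. \<forall>(x, y)\<in>R. f x = f y}. \<Prod>x\<in>X. w x (f x))
    = (\<Prod>x\<in>T. \<Sum>a\<in>B x. w x a)"
proof -
  have finT: "finite T" using X TX finite_subset by blast
  define r where "r x = (THE y. y \<in> T \<and> (x, y) \<in> R)" for x
  have r: "r x \<in> T" "(x, r x) \<in> R" if "x \<in> X" for x
    using theI'[OF T[OF that]] by (auto simp: r_def)
  have r_eq: "r x = y" if "y \<in> T" "(x, y) \<in> R" for x y
  proof -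
    have "x \<in> X" using that(2) equiv_type[OF R] by blast
    then show ?thesis using T that r by blast
  qed
  have rT: "r x = x" if "x \<in> T" for x
    by (rule r_eq[OF that]) (use that TX R in \<open>auto simp: equiv_def refl_on_def\<close>)
  have r_cong: "r x = r y" if "(x, y) \<in> R" for x y
  proof -
    have "x \<in> X" "y \<in> X" using that equiv_type[OF R] by auto
    then have "(x, r y) \<in> R" using that r(2)[of y] R unfolding equiv_def trans_def by blast
    then show ?thesis using r_eq r(1) \<open>y \<in> X\<close> by blast
  qed
  \<comment> \<open>Here \<open>B\<close> has to agree along classes: the extension takes at
    \<open>x\<close> a value from \<open>B (r x)\<close>.\<close>
  have Bfun: "f (r x) \<in> B x" if "x \<in> X" "f \<in> PiE T B" for f x
    using PiE_mem[OF that(2) r(1)[OF that(1)]] by (simp only: B(2)[OF r(2)[OF that(1)]])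
  have "(\<Sum>f\<in>{f \<in> PiE X B. \<forall>(x, y)\<in>R. f x = f y}. \<Prod>x\<in>X. w x (f x))
     = (\<Sum>f\<in>PiE T B. \<Prod>x\<in>T. w x (f x))"
  proof (rule sum.reindex_bij_witness[where j = "\<lambda>f. restrict f T" and i = "\<lambda>f. restrict (\<lambda>x. f (r x)) X"])
    fix f assume f: "f \<in> {f \<in> PiE X B. \<forall>(x, y)\<in>R. f x = f y}"
    then have "f \<in> PiE X B" by blast
    then show "restrict f T \<in> PiE T B" using TX by (auto simp: Pi_iff PiE_def)
    have fr: "f (r x) = f x" if "x \<in> X" for x
    proof -
      have "f x = f (r x)" using f r(2)[OF that] by blast
      then show ?thesis by (rule sym)
    qed
    show "restrict (\<lambda>x. restrict f T (r x)) X = f"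
    proof
      fix x
      show "restrict (\<lambda>x. restrict f T (r x)) X x = f x"
      proof (cases "x \<in> X")
        case True
        then show ?thesis by (simp only: restrict_apply' r(1) fr)
      next
        case False
        then show ?thesis using PiE_arb[OF \<open>f \<in> PiE X B\<close> False] by (simp only: restrict_def if_False)
      qed
    qed
    have "(\<Prod>x\<in>X. w x (f x)) = (\<Prod>x\<in>T. w x (f x))"
      using \<open>f \<in> PiE X B\<close> by (intro prod.mono_neutral_right X TX ballI w) auto
    then show "(\<Prod>x\<in>T. w x (restrict f T x)) = (\<Prod>x\<in>X. w x (f x))"
      by simp
  next
    fix f assume f: "f \<in> PiE T B"
    show "restrict (restrict (\<lambda>x. f (r x)) X) T = f"
    proof
      fix x
      show "restrict (restrict (\<lambda>x. f (r x)) X) T x = f x"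
        using rT[of x] TX PiE_arb[OF f, of x] by (cases "x \<in> T") auto
    qed
    have "restrict (\<lambda>x. f (r x)) X x = restrict (\<lambda>x. f (r x)) X y" if "(x, y) \<in> R" for x y
    proof -
      have "x \<in> X" "y \<in> X" using that equiv_type[OF R] by auto
      then show ?thesis by (simp add: r_cong[OF that])
    qed
    moreover have "restrict (\<lambda>x. f (r x)) X \<in> PiE X B"
      by (rule restrict_PiE_iff[THEN iffD2]) (use Bfun[OF _ f] in blast)
    ultimately show "restrict (\<lambda>x. f (r x)) X \<in> {f \<in> PiE X B. \<forall>(x, y)\<in>R. f x = f y}"
      by blast
  qed
  also have "\<dots> = (\<Prod>x\<in>T. \<Sum>a\<in>B x. w x a)"
    using TX by (intro prod_sum_PiE_semiring finT B(1)) auto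
  finally show ?thesis .
qed

section \<open>Equivalence hulls over an arbitrary carrier\<close>

definition hull_on :: "'a set \<Rightarrow> ('a \<times> 'a) set \<Rightarrow> ('a \<times> 'a) set" where
  "hull_on A r = \<Inter> {R. equiv A R \<and> r \<subseteq> R}"

text \<open>The assumption puts \<open>A \<times> A\<close> into the intersected family; over an
  empty family the intersection would be the universal relation.\<close>

lemma equiv_hull_on:
  assumes "r \<subseteq> A \<times> A"
  shows "equiv A (hull_on A r)"
proof -
  have "equiv A (A \<times> A)" by (auto simp: equiv_def refl_on_def sym_def trans_def)
  then have "hull_on A r \<subseteq> A \<times> A" using assms by (auto simp: hull_on_def)
  moreover have "refl_on A (hull_on A r)"
    by (auto simp: hull_on_def equiv_def refl_on_def)
  moreover have "sym (hull_on A r)"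
    unfolding hull_on_def equiv_def sym_def by blast
  moreover have "trans (hull_on A r)"
    unfolding hull_on_def equiv_def trans_def by blast
  ultimately show ?thesis by (simp add: equiv_def)
qed

lemma hull_on_least: "equiv A R \<Longrightarrow> r \<subseteq> R \<Longrightarrow> hull_on A r \<subseteq> R"
  by (auto simp: hull_on_def)

lemma subset_hull_on: "r \<subseteq> hull_on A r"
  by (auto simp: hull_on_def)

text \<open>The hull of \<open>s\<close>, pulled back along \<open>f\<close>, is an equivalence on
  \<open>A\<close> containing \<open>r\<close>. Used in both directions to move hulls between
  variable indices and leaf positions.\<close>

lemma hull_on_map:
  assumes "(i, j) \<in> hull_on A r" "f ` A \<subseteq> B" "r \<subseteq> A \<times> A" "s \<subseteq> B \<times> B"
    and "\<And>i j. (i, j) \<in> r \<Longrightarrow> (f i, f j) \<in> s"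
  shows "(f i, f j) \<in> hull_on B s"
proof -
  have "equiv B (hull_on B s)" using assms(4) by (rule equiv_hull_on)
  then have "equiv A {(i, j). i \<in> A \<and> j \<in> A \<and> (f i, f j) \<in> hull_on B s}"
    using assms(2) unfolding equiv_def refl_on_def sym_def trans_def by blast
  from hull_on_least[OF this, of r] show ?thesis
    using assms subset_hull_on[of s B] by blast
qed

text \<open>The kernel of \<open>f\<close> on \<open>A\<close> is an equivalence, so it contains the
  hull once it contains \<open>r\<close>. This turns obeying the constraints into being constant on
  classes.\<close>

lemma hull_on_ball_eq_iff:
  assumes "r \<subseteq> A \<times> A"
  shows "(\<forall>(x, y)\<in>hull_on A r. f x = f y) \<longleftrightarrow> (\<forall>(x, y)\<in>r. f x = f y)"
proof
  assume *: "\<forall>(x, y)\<in>r. f x = f y"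
  have "equiv A {(x, y). x \<in> A \<and> y \<in> A \<and> f x = f y}"
    by (auto simp: equiv_def refl_on_def sym_def trans_def)
  from hull_on_least[OF this, of r] show "\<forall>(x, y)\<in>hull_on A r. f x = f y"
    using * assms by blast
qed (use subset_hull_on in blast)

section \<open>Leaf positions and constraint classes\<close>

text \<open>A list and not a set, because the order from left to right ties the leaves to the
  variables of a context.\<close>

fun leaf_list :: "('f, 'z) tree \<Rightarrow> position list" where
  "leaf_list (Leaf z) = [[]]"
| "leaf_list (Node \<sigma> ts) = concat (map (\<lambda>i. map ((#) (Suc i)) (leaf_list (ts ! i))) [0..<length ts])"

abbreviation leaf_pos :: "('f, 'z) tree \<Rightarrow> position set" where
  "leaf_pos t \<equiv> set (leaf_list t)"

fun leaf_label :: "('f, 'z) tree \<Rightarrow> position \<Rightarrow> 'z" where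
  "leaf_label (Leaf z) w = z"
| "leaf_label (Node \<sigma> ts) (i # w) = leaf_label (ts ! (i - 1)) w"
| "leaf_label (Node \<sigma> ts) [] = undefined"

lemma leaf_pos_Node: "leaf_pos (Node \<sigma> ts) = (\<Union>i<length ts. (#) (Suc i) ` leaf_pos (ts ! i))"
  by auto

lemma leaf_pos_iff: "w \<in> leaf_pos t \<longleftrightarrow> w \<in> pos t \<and> (\<exists>z. subtree t w = Leaf z)"
proof (induction t w rule: subtree.induct)
  case (1 t)
  then show ?case by (cases t) auto
next
  case (2 \<sigma> ts i w)
  then show ?case by (cases i) auto
qed auto

lemma subtree_leaf_pos: "w \<in> leaf_pos t \<Longrightarrow> subtree t w = Leaf (leaf_label t w)"
proof (induction t w rule: subtree.induct)
  case (1 t)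
  then show ?case by (cases t) auto
qed (auto)

lemma pos_labelled_Inr: "pos_labelled (Inr ` Z) t = {w \<in> leaf_pos t. leaf_label t w \<in> Z}"
  using subtree_leaf_pos[of _ t]
  by (fastforce simp: pos_labelled_def label_def leaf_pos_iff split: tree.splits)

lemma distinct_leaf_list: "distinct (leaf_list t)"
proof (induction t rule: leaf_list.induct)
  case (2 \<sigma> ts)
  have "distinct (concat (map (\<lambda>i. map ((#) (Suc i)) (leaf_list (ts ! i))) [0..<n]))"
    if "n \<le> length ts" for n
    using that by (induction n) (use 2 in \<open>auto simp: distinct_map\<close>)
  then show ?case by simp
qed simp

lemma frontier_eq: "frontier t = map (leaf_label t) (leaf_list t)"
proof (induction t)
  case (Node \<sigma> ts)
  have "map frontier ts = map (\<lambda>i. frontier (ts ! i)) [0..<length ts]"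
    by (intro nth_equalityI) auto
  also have "\<dots> = map (\<lambda>i. map (leaf_label (ts ! i)) (leaf_list (ts ! i))) [0..<length ts]"
    using Node by simp
  finally show ?case by (simp add: map_concat o_def)
qed simp

lemma leaf_label_in:
  assumes "t \<in> trees \<Sigma> Z" "w \<in> leaf_pos t"
  shows "leaf_label t w \<in> Z"
  using assms by (induction arbitrary: w) auto

text \<open>Replacing leaves by leaves keeps the shape; the bound on the frontier ensures that every
  variable really selects an entry of \<open>map Leaf qs\<close>.\<close>

lemma leaf_list_subst:
  assumes "set (frontier c) \<subseteq> {1..length qs}"
  shows "leaf_list (subst c (map Leaf qs)) = leaf_list c"
  using assms
proof (induction c)
  case (Leaf i)
  then have "i - 1 < length qs" by auto
  then show ?case by simp
next
  case (Node \<sigma> ts)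
  have "leaf_list (subst (ts ! i) (map Leaf qs)) = leaf_list (ts ! i)" if "i < length ts" for i
  proof (rule Node.IH)
    show "ts ! i \<in> set ts" using that by simp
    then show "set (frontier (ts ! i)) \<subseteq> {1..length qs}" using Node.prems by auto
  qed
  then have "map (\<lambda>i. map ((#) (Suc i)) (leaf_list (map (\<lambda>t. subst t (map Leaf qs)) ts ! i))) [0..<length ts]
    = map (\<lambda>i. map ((#) (Suc i)) (leaf_list (ts ! i))) [0..<length ts]"
    by (intro map_cong refl) simp
  then show ?case by (simp only: subst.simps leaf_list.simps length_map)
qed

lemma leaf_label_subst:
  assumes "set (frontier c) \<subseteq> {1..length qs}" "w \<in> leaf_pos c"
  shows "leaf_label (subst c (map Leaf qs)) w = qs ! (leaf_label c w - 1)"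
  using assms
proof (induction c arbitrary: w)
  case (Leaf i)
  then have "i - 1 < length qs" by auto
  then show ?case by simp
next
  case (Node \<sigma> ts)
  from Node.prems(2) obtain i v where w: "w = Suc i # v" "i < length ts" "v \<in> leaf_pos (ts ! i)"
    by auto
  have "set (frontier (ts ! i)) \<subseteq> {1..length qs}"
    using Node.prems(1) nth_mem[OF w(2)] by auto
  from Node.IH[OF nth_mem[OF w(2)] this w(3)] w show ?case by simp
qed

text \<open>The new leaf label depends on the position and not on the old label, since equally
  labelled leaves may lie in constraint classes that are treated differently. With the identity in
  place of \<pi>, the function also numbers the leaves of a left-hand side, which yields its
  context.\<close>

fun map_tree :: "('f \<Rightarrow> 'g) \<Rightarrow> (position \<Rightarrow> 'y) \<Rightarrow> ('f, 'z) tree \<Rightarrow> ('g, 'y) tree" where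
  "map_tree \<pi> f (Leaf z) = Leaf (f [])"
| "map_tree \<pi> f (Node \<sigma> ts) =
    Node (\<pi> \<sigma>) (map (\<lambda>i. map_tree \<pi> (\<lambda>w. f (Suc i # w)) (ts ! i)) [0..<length ts])"

lemma leaf_list_map_tree: "leaf_list (map_tree \<pi> f t) = leaf_list t"
proof (induction \<pi> f t rule: map_tree.induct)
  case (2 \<pi> f \<sigma> ts)
  then have "map (\<lambda>i. map ((#) (Suc i)) (leaf_list (map (\<lambda>i. map_tree \<pi> (\<lambda>w. f (Suc i # w)) (ts ! i)) [0..<length ts] ! i))) [0..<length ts]
    = map (\<lambda>i. map ((#) (Suc i)) (leaf_list (ts ! i))) [0..<length ts]"
    by (intro map_cong refl) simp
  then show ?case by (simp only: map_tree.simps leaf_list.simps length_map length_upt diff_zero)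
qed simp

lemma leaf_label_map_tree: "w \<in> leaf_pos t \<Longrightarrow> leaf_label (map_tree \<pi> f t) w = f w"
  by (induction \<pi> f t arbitrary: w rule: map_tree.induct) auto

lemma subst_map_tree:
  assumes "\<And>w. w \<in> leaf_pos t \<Longrightarrow> us ! (f w - 1) = Leaf (leaf_label t w)"
  shows "subst (map_tree (\<lambda>\<sigma>. \<sigma>) f t) us = t"
  using assms
proof (induction t arbitrary: f)
  case (Node \<sigma> ts)
  have "subst (map_tree (\<lambda>\<sigma>. \<sigma>) (\<lambda>w. f (Suc i # w)) (ts ! i)) us = ts ! i" if "i < length ts" for i
  proof (rule Node.IH)
    show "ts ! i \<in> set ts" using that by simp
    fix w assume "w \<in> leaf_pos (ts ! i)"
    then show "us ! (f (Suc i # w) - 1) = Leaf (leaf_label (ts ! i) w)"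
    proof -
      have "Suc i # w \<in> leaf_pos (Node \<sigma> ts)"
        using that \<open>w \<in> leaf_pos (ts ! i)\<close> unfolding leaf_pos_Node by blast
      from Node.prems[OF this] show ?thesis by simp
    qed
  qed
  then show ?case by (auto intro: nth_equalityI)
qed simp

lemma map_tree_in_trees:
  assumes "t \<in> trees \<Sigma> Z" "relabeling \<Sigma> \<Delta> \<pi>" "\<And>w. w \<in> leaf_pos t \<Longrightarrow> f w \<in> Y"
  shows "map_tree \<pi> f t \<in> trees \<Delta> Y"
  using assms(1,3)
proof (induction arbitrary: f)
  case (Leaf z)
  then show ?case by (auto intro: trees.Leaf)
next
  case (Node \<sigma> ts)
  have "map_tree \<pi> (\<lambda>w. f (Suc i # w)) (ts ! i) \<in> trees \<Delta> Y" if "i < length ts" for i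
    using that by (intro Node.IH Node.prems) auto
  then show ?case using Node.hyps assms(2) by (auto simp: relabeling_def intro!: trees.Node)
qed

section \<open>Eq-restriction in terms of leaf positions\<close>

definition class_condition :: "('f, 'q) tree \<Rightarrow> constraints \<Rightarrow> 'q \<Rightarrow> 'q set \<Rightarrow> bool" where
  "class_condition l E b N \<longleftrightarrow> (\<forall>v\<in>leaf_pos l. \<exists>q'\<in>N.
    (\<forall>w. (v, w) \<in> hull_on (leaf_pos l) E \<longrightarrow> leaf_label l w \<in> {q', b}) \<and>
    (\<exists>!w. (v, w) \<in> hull_on (leaf_pos l) E \<and> leaf_label l w = q'))"

text \<open>The context arises by numbering the leaves from left to right, starting with 1; the
  number of a leaf is well defined because \<open>leaf_list\<close> is distinct.\<close>

lemma ex_contexts_decomposition: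
  assumes "l \<in> trees \<Sigma> N"
  shows "\<exists>c. c \<in> contexts \<Sigma> (length (frontier l)) \<and> l = subst c (map Leaf (frontier l))"
proof -
  let ?n = "length (frontier l)"
  have n: "?n = length (leaf_list l)" by (simp add: frontier_eq)
  define f where "f w = Suc (THE i. i < ?n \<and> leaf_list l ! i = w)" for w
  have f: "f (leaf_list l ! i) = Suc i" if "i < ?n" for i
    unfolding f_def using that distinct_leaf_list[of l]
    by (auto simp: n nth_eq_iff_index_eq intro!: the_equality)
  let ?c = "map_tree (\<lambda>\<sigma>. \<sigma>) f l"
  have "frontier ?c = map f (leaf_list l)"
    by (simp add: frontier_eq leaf_list_map_tree leaf_label_map_tree)
  also have "\<dots> = [1..<?n + 1]"
    using f by (intro nth_equalityI) (simp_all add: n del: upt_Suc)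
  finally have "frontier ?c = [1..<?n + 1]" .
  moreover have "?c \<in> trees \<Sigma> {1..?n}"
    using f by (intro map_tree_in_trees[OF assms]) (auto simp: relabeling_def in_set_conv_nth n)
  moreover have "subst ?c (map Leaf (frontier l)) = l"
    using f by (intro subst_map_tree) (auto simp: in_set_conv_nth n, simp add: frontier_eq)
  ultimately show ?thesis unfolding contexts_def by auto
qed

lemma equiv_hull_conv_hull_on: "equiv_hull k r = hull_on {1..k} r"
  by (simp add: equiv_hull_def hull_on_def)

text \<open>Sending \<open>j\<close> to the position of the variable with index \<open>j\<close> is
  a bijection onto the leaf positions. It carries \<open>var_pairs\<close> to \<open>E\<close>,
  hence one hull to the other, and with them both conditions.\<close>

lemma class_condition_decomposition:
  assumes c: "c \<in> contexts \<Sigma> k" and qs: "length qs = k" and l: "l = subst c (map Leaf qs)"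
    and E: "E \<subseteq> leaf_pos l \<times> leaf_pos l"
  shows "(\<forall>i\<in>{1..k}. \<exists>q'\<in>N.
        (let J = equiv_hull k (var_pairs c k E) `` {i} in
          {qs ! (j - 1) | j. j \<in> J} \<subseteq> {q', b} \<and>
          (\<exists>!j. j \<in> J \<and> qs ! (j - 1) = q'))) \<longleftrightarrow> class_condition l E b N"
proof -
  define p where "p j = leaf_list l ! (j - 1)" for j
  let ?R = "var_pairs c k E" and ?P = "leaf_pos l"
  have fr: "frontier c = [1..<k + 1]" "set (frontier c) \<subseteq> {1..length qs}"
    using c qs by (auto simp: contexts_def)
  have lc: "leaf_list l = leaf_list c" using fr l by (simp add: leaf_list_subst)
  have len: "length (leaf_list l) = k"
    using arg_cong[OF fr(1), of length] by (simp add: frontier_eq lc)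
  have p_in: "p j \<in> ?P" if "j \<in> {1..k}" for j
    using that len by (auto simp: p_def intro!: nth_mem)
  have lab_c: "leaf_label c (p j) = j" if "j \<in> {1..k}" for j
  proof -
    have "j - 1 < length (leaf_list c)" using that len lc by auto
    then have "leaf_label c (p j) = frontier c ! (j - 1)"
      by (simp add: p_def frontier_eq lc)
    then show ?thesis using that fr(1) by (simp del: upt_Suc)
  qed
  have bij: "bij_betw p {1..k} ?P"
  proof (rule bij_betw_imageI)
    show "inj_on p {1..k}" using lab_c by (metis inj_onI)
    show "p ` {1..k} = ?P"
    proof (intro equalityI subsetI)
      fix w assume "w \<in> ?P"
      then obtain i where "i < k" "w = leaf_list l ! i" using len by (auto simp: in_set_conv_nth)
      then have "w = p (Suc i)" "Suc i \<in> {1..k}" by (auto simp: p_def)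
      then show "w \<in> p ` {1..k}" by blast
    qed (use p_in in auto)
  qed
  have lab: "leaf_label l (p j) = qs ! (j - 1)" if "j \<in> {1..k}" for j
    using leaf_label_subst[OF fr(2), of "p j"] p_in[OF that] lab_c[OF that] unfolding l lc[unfolded l] by simp
  have labelled: "pos_labelled {Inr j} c = {p j}" if "j \<in> {1..k}" for j
  proof -
    have "pos_labelled {Inr j} c = {w \<in> ?P. leaf_label c w = j}"
      using pos_labelled_Inr[of "{j}" c] lc by simp
    also have "\<dots> = {p j}"
    proof (intro equalityI subsetI)
      fix w assume w: "w \<in> {w \<in> ?P. leaf_label c w = j}"
      then obtain i where "i \<in> {1..k}" "w = p i"
        unfolding bij_betw_imp_surj_on[OF bij, symmetric] by blast
      then show "w \<in> {p j}" using w lab_c[of i] by simp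
    qed (use p_in[OF that] lab_c[OF that] in simp)
    finally show ?thesis .
  qed
  \<comment> \<open>Each variable occurs at exactly one position, so a pair of indices stems from
    just one pair of positions.\<close>
  have R: "(i, j) \<in> ?R \<longleftrightarrow> i \<in> {1..k} \<and> j \<in> {1..k} \<and> (p i, p j) \<in> E" for i j
    using labelled unfolding var_pairs_def by auto
  define p' where "p' = inv_into {1..k} p"
  have p'p: "p' (p j) = j" if "j \<in> {1..k}" for j
    using bij that by (simp add: p'_def bij_betw_def)
  have pp': "p (p' w) = w" "p' w \<in> {1..k}" if "w \<in> ?P" for w
    using that unfolding p'_def bij_betw_imp_surj_on[OF bij, symmetric]
    by (rule f_inv_into_f, rule inv_into_into)
  have R_sub: "?R \<subseteq> {1..k} \<times> {1..k}" by (auto simp: R)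
  have hull: "(i, j) \<in> equiv_hull k ?R \<longleftrightarrow> (p i, p j) \<in> hull_on ?P E"
    if ij: "i \<in> {1..k}" "j \<in> {1..k}" for i j
  proof
    assume "(i, j) \<in> equiv_hull k ?R"
    then show "(p i, p j) \<in> hull_on ?P E"
      unfolding equiv_hull_conv_hull_on
      by (rule hull_on_map[OF _ _ R_sub E]) (use p_in R in auto)
  next
    assume "(p i, p j) \<in> hull_on ?P E"
    then have "(p' (p i), p' (p j)) \<in> hull_on {1..k} ?R"
    proof (rule hull_on_map[OF _ _ E R_sub])
      show "p' ` ?P \<subseteq> {1..k}" using pp'(2) by blast
      fix v w assume "(v, w) \<in> E"
      then show "(p' v, p' w) \<in> ?R" using E pp' unfolding R by auto
    qed
    then show "(i, j) \<in> equiv_hull k ?R" by (simp only: p'p[OF ij(1)] p'p[OF ij(2)] equiv_hull_conv_hull_on)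
  qed
  have in1: "j \<in> {1..k}" if "(i, j) \<in> equiv_hull k ?R" for i j
    using that equiv_type[OF equiv_hull_on[OF R_sub]] unfolding equiv_hull_conv_hull_on by auto
  have inP: "w \<in> ?P" if "(v, w) \<in> hull_on ?P E" for v w
    using that equiv_type[OF equiv_hull_on[OF E]] by auto
  have cond: "(let J = equiv_hull k ?R `` {i} in
          {qs ! (j - 1) | j. j \<in> J} \<subseteq> {q', b} \<and> (\<exists>!j. j \<in> J \<and> qs ! (j - 1) = q')) \<longleftrightarrow>
      (\<forall>w. (p i, w) \<in> hull_on ?P E \<longrightarrow> leaf_label l w \<in> {q', b}) \<and>
      (\<exists>!w. (p i, w) \<in> hull_on ?P E \<and> leaf_label l w = q')" if i: "i \<in> {1..k}" for i q'
  proof -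
    have J: "j \<in> equiv_hull k ?R `` {i} \<longleftrightarrow> j \<in> {1..k} \<and> (p i, p j) \<in> hull_on ?P E" for j
      using in1 hull i by blast
    have 1: "{qs ! (j - 1) | j. j \<in> equiv_hull k ?R `` {i}} \<subseteq> {q', b} \<longleftrightarrow>
      (\<forall>w. (p i, w) \<in> hull_on ?P E \<longrightarrow> leaf_label l w \<in> {q', b})" (is "?A \<subseteq> _ \<longleftrightarrow> _")
    proof
      assume A: "?A \<subseteq> {q', b}"
      show "\<forall>w. (p i, w) \<in> hull_on ?P E \<longrightarrow> leaf_label l w \<in> {q', b}"
      proof (intro allI impI)
        fix w assume w: "(p i, w) \<in> hull_on ?P E"
        then have wP: "w \<in> ?P" by (rule inP)
        have "qs ! (p' w - 1) = leaf_label l w" using lab[OF pp'(2)[OF wP]] pp'(1)[OF wP] by simp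
        moreover have "p' w \<in> equiv_hull k ?R `` {i}" 
          using w pp'[OF wP] by (intro J[THEN iffD2]) (simp only: simp_thms)
        ultimately have "leaf_label l w \<in> ?A" by (simp only: mem_Collect_eq) (intro exI conjI, rule sym)
        then show "leaf_label l w \<in> {q', b}" by (rule subsetD[OF A])
      qed
    next
      assume *: "\<forall>w. (p i, w) \<in> hull_on ?P E \<longrightarrow> leaf_label l w \<in> {q', b}"
      show "?A \<subseteq> {q', b}"
      proof
        fix x assume "x \<in> ?A"
        then obtain j where j: "x = qs ! (j - 1)" "j \<in> equiv_hull k ?R `` {i}" by blast
        from J[THEN iffD1, OF j(2)] have jk: "j \<in> {1..k}" "(p i, p j) \<in> hull_on ?P E" by auto
        then show "x \<in> {q', b}" using * unfolding j(1) lab[OF jk(1), symmetric] by blast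
      qed
    qed
    let ?W = "\<lambda>w. (p i, w) \<in> hull_on ?P E \<and> leaf_label l w = q'"
    have "j \<in> equiv_hull k ?R `` {i} \<and> qs ! (j - 1) = q' \<longleftrightarrow> j \<in> {1..k} \<and> ?W (p j)" for j
      using J[of j] lab[of j] by (cases "j \<in> {1..k}") (simp_all only: simp_thms)
    then have "(\<exists>!j. j \<in> equiv_hull k ?R `` {i} \<and> qs ! (j - 1) = q') \<longleftrightarrow> (\<exists>!j. j \<in> {1..k} \<and> ?W (p j))"
      by (intro arg_cong[where f = Ex1] ext)
    also have "\<dots> \<longleftrightarrow> (\<exists>!w. ?W w)"
    proof
      assume "\<exists>!j. j \<in> {1..k} \<and> ?W (p j)"
      then obtain j where j: "j \<in> {1..k} \<and> ?W (p j)" "\<forall>j'. j' \<in> {1..k} \<and> ?W (p j') \<longrightarrow> j' = j"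
        by (rule ex1E)
      show "\<exists>!w. ?W w"
      proof (rule ex1I[of _ "p j"])
        fix w assume w: "?W w"
        then have wP: "w \<in> ?P" using inP by blast
        have "p' w \<in> {1..k} \<and> ?W (p (p' w))" using w pp'(2)[OF wP] by (simp only: pp'(1)[OF wP])
        then have "p' w = j" using j(2) by blast
        then show "w = p j" using pp'(1)[OF wP] by simp
      qed (use j in blast)
    next
      assume "\<exists>!w. ?W w"
      then obtain w where w: "?W w" "\<forall>w'. ?W w' \<longrightarrow> w' = w"
        by (rule ex1E)
      have wP: "w \<in> ?P" using w(1) inP by blast
      show "\<exists>!j. j \<in> {1..k} \<and> ?W (p j)"
      proof (rule ex1I[of _ "p' w"])
        fix j assume j: "j \<in> {1..k} \<and> ?W (p j)"
        then have "p j = w" using w(2) by blast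
        then show "j = p' w" using j p'p[of j] by simp
      qed (use w(1) pp'[OF wP] in simp)
    qed
    finally show ?thesis unfolding Let_def 1 by simp
  qed
  \<comment> \<open>The symmetric rewriting makes the bounded quantifier range over indices; the
    second \<open>unfolding\<close> restores the position sets inside the hull.\<close>
  show ?thesis
    unfolding class_condition_def bij_betw_imp_surj_on[OF bij, symmetric] ball_simps
    unfolding bij_betw_imp_surj_on[OF bij]
    by (intro ball_cong bex_cong refl cond)
qed

lemma classic_constraints:
  assumes "classic G" "(l, q, E, I) \<in> productions G"
  shows "E \<subseteq> leaf_pos l \<times> leaf_pos l"
  using assms by (fastforce simp: classic_def pos_labelled_Inr)

lemma ball_prod4_cong:
  assumes "\<And>a b c d. (a, b, c, d) \<in> S \<Longrightarrow> P a b c d \<longleftrightarrow> Q a b c d"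
  shows "(\<forall>(a, b, c, d)\<in>S. P a b c d) \<longleftrightarrow> (\<forall>(a, b, c, d)\<in>S. Q a b c d)"
  using assms by auto

lemma eq_restricted_iff:
  assumes "wtgc G" "classic G"
  shows "eq_restricted G \<longleftrightarrow> (\<exists>b. sink G b \<and>
    (\<forall>(l, q, E, I)\<in>productions G. class_condition l E b (nonterminals G)))"
proof -
  have "(\<forall>k c qs. c \<in> contexts (alphabet G) k \<and> length qs = k \<and> set qs \<subseteq> nonterminals G \<and>
      l = subst c (map Leaf qs) \<longrightarrow>
      (\<forall>i\<in>{1..k}. \<exists>q'\<in>nonterminals G.
        (let J = equiv_hull k (var_pairs c k E) `` {i} in
          {qs ! (j - 1) | j. j \<in> J} \<subseteq> {q', b} \<and>
          (\<exists>!j. j \<in> J \<and> qs ! (j - 1) = q')))) \<longleftrightarrow> class_condition l E b (nonterminals G)"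
    (is "?L \<longleftrightarrow> ?R")
    if p: "(l, q, E, I) \<in> productions G" for l q E I b
  proof
    have l: "l \<in> trees (alphabet G) (nonterminals G)" using assms(1) p by (auto simp: wtgc_def)
    obtain c where c: "c \<in> contexts (alphabet G) (length (frontier l))" "l = subst c (map Leaf (frontier l))"
      using ex_contexts_decomposition[OF l] by blast
    have "set (frontier l) \<subseteq> nonterminals G"
      using leaf_label_in[OF l] by (auto simp: frontier_eq)
    then have "c \<in> contexts (alphabet G) (length (frontier l)) \<and> length (frontier l) = length (frontier l) \<and>
        set (frontier l) \<subseteq> nonterminals G \<and> l = subst c (map Leaf (frontier l))"
      using c by (intro conjI refl)
    moreover assume ?L
    ultimately show ?R
      unfolding class_condition_decomposition[OF c(1) refl c(2) classic_constraints[OF assms(2) p], symmetric]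
      by (elim allE) (erule (1) mp)
  next
    assume ?R
    show ?L
    proof (intro allI impI, elim conjE)
      fix k c qs
      assume c: "c \<in> contexts (alphabet G) k" and qs: "length qs = k" and l: "l = subst c (map Leaf qs)"
      show "\<forall>i\<in>{1..k}. \<exists>q'\<in>nonterminals G.
        (let J = equiv_hull k (var_pairs c k E) `` {i} in
          {qs ! (j - 1) | j. j \<in> J} \<subseteq> {q', b} \<and> (\<exists>!j. j \<in> J \<and> qs ! (j - 1) = q'))"
        using \<open>?R\<close> unfolding class_condition_decomposition[OF c qs l classic_constraints[OF assms(2) p]] .
    qed
  qed
  then have "(\<forall>(l, q, E, I)\<in>productions G. \<forall>k c qs.
      c \<in> contexts (alphabet G) k \<and> length qs = k \<and> set qs \<subseteq> nonterminals G \<and>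
      l = subst c (map Leaf qs) \<longrightarrow>
      (\<forall>i\<in>{1..k}. \<exists>q'\<in>nonterminals G.
        (let J = equiv_hull k (var_pairs c k E) `` {i} in
          {qs ! (j - 1) | j. j \<in> J} \<subseteq> {q', b} \<and>
          (\<exists>!j. j \<in> J \<and> qs ! (j - 1) = q')))) \<longleftrightarrow>
      (\<forall>(l, q, E, I)\<in>productions G. class_condition l E b (nonterminals G))" for b
    by (rule ball_prod4_cong)
  then show ?thesis
    unfolding eq_restricted_def using assms(2) by (simp only: simp_thms)
qed

section \<open>Decomposition of derivations\<close>

text \<open>The part of a derivation inside child \<open>i\<close>, with positions taken relative to
  that child.\<close>

definition proj :: "nat \<Rightarrow> ('p \<times> position) list \<Rightarrow> ('p \<times> position) list" where
  "proj i d = map (apsnd tl) (filter (\<lambda>pw. snd pw \<noteq> [] \<and> hd (snd pw) = i) d)"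

definition shift :: "nat \<Rightarrow> ('p \<times> position) list \<Rightarrow> ('p \<times> position) list" where
  "shift i d = map (apsnd ((#) i)) d"

text \<open>Appending from left to right is the interleaving that the leftmost order prescribes. The
  family \<open>f\<close> counts the children from 0, positions count them from 1.\<close>

primrec join :: "nat \<Rightarrow> (nat \<Rightarrow> ('p \<times> position) list) \<Rightarrow> ('p \<times> position) list" where
  "join 0 f = []"
| "join (Suc n) f = join n f @ shift (Suc n) (f n)"

lemma proj_Nil [simp]: "proj i [] = []"
  by (simp add: proj_def)

lemma proj_Cons [simp]: "proj i ((p, j # w) # d) = (if i = j then (p, w) # proj i d else proj i d)"
  by (simp add: proj_def)

lemma proj_append: "proj i (d @ d') = proj i d @ proj i d'"
  by (simp add: proj_def)

lemma proj_shift: "proj i (shift j d) = (if i = j then d else [])"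
  by (induction d) (auto simp: shift_def apsnd_def)

lemma proj_join: "proj (Suc i) (join n f) = (if i < n then f i else [])"
  by (induction n) (auto simp: proj_append proj_shift less_Suc_eq)

lemma set_join: "pw \<in> set (join n f) \<longleftrightarrow> (\<exists>i<n. \<exists>(p, w)\<in>set (f i). pw = (p, Suc i # w))"
proof (induction n)
  case (Suc n)
  have "pw \<in> set (join (Suc n) f) \<longleftrightarrow>
      pw \<in> set (join n f) \<or> (\<exists>(p, w)\<in>set (f n). pw = (p, Suc n # w))"
    by (simp add: shift_def image_iff case_prod_unfold apsnd_def map_prod_def)
  then show ?case unfolding Suc.IH less_Suc_eq by blast
qed simp

lemma join_cong: "(\<And>i. i < n \<Longrightarrow> f i = g i) \<Longrightarrow> join n f = join n g"
  by (induction n) auto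

abbreviation leftmost :: "('p \<times> position) list \<Rightarrow> bool" where
  "leftmost d \<equiv> sorted_wrt pos_less (map snd d)"

lemma leftmost_shift: "leftmost (shift i d) \<longleftrightarrow> leftmost d"
  by (simp add: shift_def sorted_wrt_map)

lemma leftmost_join:
  assumes "\<And>i. i < n \<Longrightarrow> leftmost (f i)"
  shows "leftmost (join n f)"
  using assms
proof (induction n)
  case (Suc n)
  have "pos_less v w" if "v \<in> snd ` set (join n f)" "w \<in> snd ` set (shift (Suc n) (f n))" for v w
    using that by (auto simp: set_join shift_def)
  moreover have "leftmost (shift (Suc n) (f n))"
    unfolding leftmost_shift using Suc.prems by simp
  ultimately show ?case using Suc by (simp add: sorted_wrt_append)
qed simp

lemma leftmost_proj:
  assumes "leftmost d"
  shows "leftmost (proj i d)"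
  using assms
proof (induction d)
  case (Cons pw d)
  obtain p w where pw: "pw = (p, w)" by (cases pw)
  show ?case
  proof (cases w)
    case Nil
    then show ?thesis using Cons by (simp add: pw proj_def)
  next
    case w: (Cons j v)
    have "pos_less v u" if "u \<in> snd ` set (proj j d)" for u
    proof -
      from that obtain q where "(q, j # u) \<in> set d"
        by (auto simp: proj_def neq_Nil_conv)
      then show ?thesis using Cons.prems by (force simp: pw w)
    qed
    then show ?thesis using Cons by (auto simp: pw w)
  qed
qed simp

text \<open>By the hypothesis, the elements satisfying \<open>Q\<close> form a prefix of the
  list.\<close>

lemma filter_split:
  assumes "sorted_wrt (\<lambda>x y. Q y \<longrightarrow> Q x) d"
  shows "d = filter Q d @ filter (\<lambda>x. \<not> Q x) d"
  using assms
proof (induction d)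
  case (Cons x d)
  then show ?case by (cases "Q x") (auto simp: filter_empty_conv filter_id_conv)
qed simp

text \<open>In a leftmost sequence without root steps, all steps in the first \<open>n\<close>
  children precede those in the child \<open>Suc n\<close>. The latter can be cut off at the end,
  and induction treats the rest.\<close>

lemma join_proj:
  assumes "leftmost d" "\<And>p w. (p, w) \<in> set d \<Longrightarrow> \<exists>i<n. \<exists>v. w = Suc i # v"
  shows "join n (\<lambda>i. proj (Suc i) d) = d"
  using assms
proof (induction n arbitrary: d)
  case 0
  then show ?case by (cases d) auto
next
  case (Suc n)
  let ?Q = "\<lambda>pw. hd (snd pw) \<le> n"
  let ?d1 = "filter ?Q d" and ?d2 = "filter (\<lambda>pw. \<not> ?Q pw) d"
  have "sorted_wrt (\<lambda>x y. pos_less (snd x) (snd y)) d"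
    using Suc.prems(1) by (simp add: sorted_wrt_map)
  then have "sorted_wrt (\<lambda>x y. ?Q y \<longrightarrow> ?Q x) d"
  proof (rule sorted_wrt_mono_rel[rotated])
    fix x y assume "x \<in> set d" "y \<in> set d" "pos_less (snd x) (snd y)"
    then show "?Q y \<longrightarrow> ?Q x"
      using Suc.prems(2)[of "fst x" "snd x"] Suc.prems(2)[of "fst y" "snd y"] by auto
  qed
  then have d: "d = ?d1 @ ?d2" by (rule filter_split)
  have "leftmost ?d1"
    using Suc.prems(1) by (simp add: sorted_wrt_map sorted_wrt_filter)
  moreover have "\<exists>i<n. \<exists>v. w = Suc i # v" if "(p, w) \<in> set ?d1" for p w
    using Suc.prems(2)[of p w] that by auto
  ultimately have "join n (\<lambda>i. proj (Suc i) ?d1) = ?d1" by (rule Suc.IH)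
  moreover have "proj (Suc i) ?d1 = proj (Suc i) d" if "i < n" for i
    using that unfolding proj_def filter_filter by (intro arg_cong[where f = "map _"] filter_cong refl) auto
  ultimately have 1: "join n (\<lambda>i. proj (Suc i) d) = ?d1"
    using join_cong[of n "\<lambda>i. proj (Suc i) ?d1" "\<lambda>i. proj (Suc i) d"] by simp
  have eq: "filter (\<lambda>pw. snd pw \<noteq> [] \<and> hd (snd pw) = Suc n) d = ?d2"
    using Suc.prems(2) by (intro filter_cong refl) (fastforce simp: less_Suc_eq)
  have "shift (Suc n) (proj (Suc n) d) = ?d2"
    unfolding shift_def proj_def eq map_map
    by (intro map_idI) (use Suc.prems(2) in \<open>fastforce simp: less_Suc_eq\<close>)
  then show ?case using 1 d by simp
qed

lemma pos_Node_Cons [simp]: "j # w \<in> pos (Node \<sigma> ts) \<longleftrightarrow> (\<exists>i<length ts. j = Suc i \<and> w \<in> pos (ts ! i))"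
  by auto

lemma step_Node:
  "step G (Node \<tau> ts) p (j # w) (Node \<sigma> \<xi>s) \<zeta> \<longleftrightarrow>
    (\<exists>i<length \<xi>s. j = Suc i \<and> (\<exists>\<xi>'. step G (ts ! i) p w (\<xi>s ! i) \<xi>' \<and> \<zeta> = Node \<sigma> (\<xi>s[i := \<xi>'])))"
  unfolding step_def by (auto split: prod.splits)

lemma steps_append: "steps G t (d @ d') \<xi> \<zeta> \<longleftrightarrow> (\<exists>\<xi>'. steps G t d \<xi> \<xi>' \<and> steps G t d' \<xi>' \<zeta>)"
  by (induction d arbitrary: \<xi>) auto

text \<open>Away from the root, a step changes one child only and tests its constraints inside the
  same child of the input tree. Hence the children evolve independently, and only the projections
  matter, whatever the interleaving.\<close>

lemma steps_Node:
  assumes "[] \<notin> snd ` set d"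
  shows "steps G (Node \<tau> ts) d (Node \<sigma> \<xi>s) \<zeta> \<longleftrightarrow>
    (\<forall>(p, w)\<in>set d. \<exists>i<length \<xi>s. \<exists>v. w = Suc i # v) \<and>
    (\<exists>\<zeta>s. \<zeta> = Node \<sigma> \<zeta>s \<and> length \<zeta>s = length \<xi>s \<and>
      (\<forall>i<length \<xi>s. steps G (ts ! i) (proj (Suc i) d) (\<xi>s ! i) (\<zeta>s ! i)))"
  using assms
proof (induction d arbitrary: \<xi>s)
  case Nil
  show ?case by (auto intro: nth_equalityI)
next
  case (Cons pw d)
  obtain p w where pw: "pw = (p, w)" by (cases pw)
  obtain j v where w: "w = j # v" using Cons.prems pw by (cases w) auto
  have IH: "steps G (Node \<tau> ts) d (Node \<sigma> \<xi>s) \<zeta> \<longleftrightarrow>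
    (\<forall>(p, w)\<in>set d. \<exists>i<length \<xi>s. \<exists>v. w = Suc i # v) \<and>
    (\<exists>\<zeta>s. \<zeta> = Node \<sigma> \<zeta>s \<and> length \<zeta>s = length \<xi>s \<and>
      (\<forall>i<length \<xi>s. steps G (ts ! i) (proj (Suc i) d) (\<xi>s ! i) (\<zeta>s ! i)))" for \<xi>s
    using Cons.prems by (intro Cons.IH) simp
  show ?case
  proof (cases "\<exists>i<length \<xi>s. j = Suc i")
    case False
    then show ?thesis by (auto simp: pw w step_Node)
  next
    case True
    then obtain i where i: "i < length \<xi>s" "j = Suc i" by blast
    have "steps G (Node \<tau> ts) (pw # d) (Node \<sigma> \<xi>s) \<zeta> \<longleftrightarrow>
      (\<exists>\<xi>'. step G (ts ! i) p v (\<xi>s ! i) \<xi>' \<and> steps G (Node \<tau> ts) d (Node \<sigma> (\<xi>s[i := \<xi>'])) \<zeta>)"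
      using i by (auto simp: pw w step_Node)
    also have "\<dots> \<longleftrightarrow> (\<forall>(p, w)\<in>set d. \<exists>i<length \<xi>s. \<exists>v. w = Suc i # v) \<and>
      (\<exists>\<zeta>s. \<zeta> = Node \<sigma> \<zeta>s \<and> length \<zeta>s = length \<xi>s \<and>
        (\<exists>\<xi>'. step G (ts ! i) p v (\<xi>s ! i) \<xi>' \<and>
          (\<forall>k<length \<xi>s. steps G (ts ! k) (proj (Suc k) d) (\<xi>s[i := \<xi>'] ! k) (\<zeta>s ! k))))"
      unfolding IH by (simp only: length_list_update) blast
    \<comment> \<open>The first step becomes the head of the projection to child \<open>i\<close>
      and leaves the other projections unchanged.\<close>
    also have "(\<lambda>\<zeta>s. \<exists>\<xi>'. step G (ts ! i) p v (\<xi>s ! i) \<xi>' \<and>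
          (\<forall>k<length \<xi>s. steps G (ts ! k) (proj (Suc k) d) (\<xi>s[i := \<xi>'] ! k) (\<zeta>s ! k))) =
        (\<lambda>\<zeta>s. \<forall>k<length \<xi>s. steps G (ts ! k) (proj (Suc k) (pw # d)) (\<xi>s ! k) (\<zeta>s ! k))"
    proof (intro ext iffI)
      fix \<zeta>s
      assume "\<exists>\<xi>'. step G (ts ! i) p v (\<xi>s ! i) \<xi>' \<and>
          (\<forall>k<length \<xi>s. steps G (ts ! k) (proj (Suc k) d) (\<xi>s[i := \<xi>'] ! k) (\<zeta>s ! k))"
      then show "\<forall>k<length \<xi>s. steps G (ts ! k) (proj (Suc k) (pw # d)) (\<xi>s ! k) (\<zeta>s ! k)"
        using i by (auto simp: pw w nth_list_update split: if_splits)
    next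
      fix \<zeta>s
      assume *: "\<forall>k<length \<xi>s. steps G (ts ! k) (proj (Suc k) (pw # d)) (\<xi>s ! k) (\<zeta>s ! k)"
      then have "steps G (ts ! i) ((p, v) # proj (Suc i) d) (\<xi>s ! i) (\<zeta>s ! i)"
        using i by (auto simp: pw w)
      then obtain \<xi>' where "step G (ts ! i) p v (\<xi>s ! i) \<xi>'"
        "steps G (ts ! i) (proj (Suc i) d) \<xi>' (\<zeta>s ! i)" by auto
      moreover have "steps G (ts ! k) (proj (Suc k) d) (\<xi>s ! k) (\<zeta>s ! k)" if "k < length \<xi>s" "k \<noteq> i" for k
        using *[rule_format, OF that(1)] that(2) i by (simp add: pw w)
      ultimately show "\<exists>\<xi>'. step G (ts ! i) p v (\<xi>s ! i) \<xi>' \<and>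
          (\<forall>k<length \<xi>s. steps G (ts ! k) (proj (Suc k) d) (\<xi>s[i := \<xi>'] ! k) (\<zeta>s ! k))"
        using i by (auto simp: nth_list_update)
    qed
    finally show ?thesis using i by (simp add: pw w)
  qed
qed

section \<open>Runs from a tree to an arbitrary sentential form\<close>

lemma wtgc_production:
  assumes "wtgc G" "(l, q, E, I) \<in> productions G"
  shows "l \<in> trees (alphabet G) (nonterminals G)" "l \<notin> Leaf ` nonterminals G" "q \<in> nonterminals G"
    "finite E" "finite I"
  using assms by (auto simp: wtgc_def)

lemma production_Leaf:
  assumes "wtgc G"
  shows "(Leaf z, q, E, I) \<notin> productions G"
proof
  assume "(Leaf z, q, E, I) \<in> productions G"
  from wtgc_production(1,2)[OF assms this] show False by (auto elim: trees.cases)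
qed

text \<open>No left-hand side is a single leaf, so a leaf cannot be rewritten.\<close>

lemma steps_from_Leaf:
  assumes "wtgc G" "steps G t d (Leaf z) \<zeta>"
  shows "d = [] \<and> \<zeta> = Leaf z"
proof (cases d)
  case (Cons pw d')
  obtain l q E I where "fst pw = (l, q, E, I)" by (cases "fst pw")
  then show ?thesis
    using Cons assms production_Leaf[OF assms(1)] by (auto simp: step_def)
qed (use assms in auto)

text \<open>A step at the root produces a leaf, and a leaf is stuck.\<close>

lemma steps_to_Node_nonroot:
  assumes "wtgc G" "steps G t d \<xi> (Node \<sigma> \<zeta>s)"
  shows "[] \<notin> snd ` set d"
  using assms(2)
proof (induction d arbitrary: \<xi>)
  case (Cons pw d)
  then obtain \<xi>' where \<xi>': "step G t (fst pw) (snd pw) \<xi> \<xi>'" "steps G t d \<xi>' (Node \<sigma> \<zeta>s)" by auto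
  have "snd pw \<noteq> []"
  proof
    assume "snd pw = []"
    with \<xi>'(1) obtain q where "\<xi>' = Leaf q" by (auto simp: step_def split: prod.splits)
    with \<xi>'(2) steps_from_Leaf[OF assms(1)] show False by blast
  qed
  then show ?case using Cons \<xi>'(2) by auto
qed simp

lemma step_to_Leaf:
  assumes "step G t p w \<xi> (Leaf q)"
  shows "w = []"
proof (cases w)
  case (Cons j v)
  then show ?thesis using assms by (cases \<xi>) (auto simp: step_def split: prod.splits)
qed

text \<open>Derivations with an arbitrary end \<zeta>: what precedes the final root step is a run to
  a left-hand side, and within it the children reach the subtrees of that left-hand side.\<close>

definition runs :: "('q, 'f, 's) wtgc \<Rightarrow> 'f gtree \<Rightarrow> ('f, 'q) tree \<Rightarrow> (('f, 'q) production \<times> position) list set" where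
  "runs G g \<zeta> = {d. steps G (emb g) d (emb g) \<zeta> \<and> leftmost d}"

definition applicable :: "('q, 'f, 's) wtgc \<Rightarrow> 'f gtree \<Rightarrow> 'q \<Rightarrow> ('f, 'q) production set" where
  "applicable G g q = {(l, q', E, I) \<in> productions G. q' = q \<and>
    (\<forall>e\<in>E. satisfies (emb g :: ('f, 'q) tree) e) \<and> (\<forall>e\<in>I. \<not> satisfies (emb g :: ('f, 'q) tree) e)}"

text \<open>Only a root step can produce a leaf, so the last step is at the root. Conversely, a run
  to a left-hand side contains no root step, and since the root is the largest position, appending
  one keeps the run leftmost.\<close>

lemma runs_Leaf:
  assumes "wtgc G"
  shows "runs G g (Leaf q) =
    (\<lambda>(p, d). d @ [(p, [])]) ` Sigma (applicable G g q) (\<lambda>p. runs G g (fst p))"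
proof (intro equalityI subsetI)
  fix d assume "d \<in> runs G g (Leaf q)"
  then have d: "steps G (emb g) d (emb g) (Leaf q)" "leftmost d" by (auto simp: runs_def)
  have "d \<noteq> []" using d(1) by (cases g) auto
  then obtain d' p w where d': "d = d' @ [(p, w)]"
    by (metis append_butlast_last_id surj_pair)
  with d(1) obtain \<xi> where \<xi>: "steps G (emb g) d' (emb g) \<xi>" "step G (emb g) p w \<xi> (Leaf q)"
    by (auto simp: steps_append)
  have w: "w = []" using step_to_Leaf[OF \<xi>(2)] .
  have p: "p \<in> applicable G g q" "\<xi> = fst p"
    using \<xi>(2) by (auto simp: w step_def applicable_def)
  have "leftmost d'" using d(2) by (simp add: d' sorted_wrt_append)
  then have "(p, d') \<in> Sigma (applicable G g q) (\<lambda>p. runs G g (fst p))"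
    using \<xi>(1) p by (simp add: runs_def)
  then show "d \<in> (\<lambda>(p, d). d @ [(p, [])]) ` Sigma (applicable G g q) (\<lambda>p. runs G g (fst p))"
    unfolding d' w by (rule rev_image_eqI) simp
next
  fix d assume "d \<in> (\<lambda>(p, d). d @ [(p, [])]) ` Sigma (applicable G g q) (\<lambda>p. runs G g (fst p))"
  then obtain l E I d' where p: "(l, q, E, I) \<in> applicable G g q" "d' \<in> runs G g l"
    and d: "d = d' @ [((l, q, E, I), [])]" by (auto simp: applicable_def)
  have "(l, q, E, I) \<in> productions G" using p by (auto simp: applicable_def)
  then obtain \<sigma> ls where l: "l = Node \<sigma> ls" using production_Leaf[OF assms] by (cases l) auto
  have "step G (emb g) (l, q, E, I) [] l (Leaf q)"
    using p by (cases l) (auto simp: step_def applicable_def)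
  then have "steps G (emb g) d (emb g) (Leaf q)"
    using p(2) by (auto simp: d steps_append runs_def)
  moreover have "pos_less w []" if "(p, w) \<in> set d'" for p w
  proof -
    have "steps G (emb g) d' (emb g) (Node \<sigma> ls)" using p(2) l by (simp add: runs_def)
    from steps_to_Node_nonroot[OF assms this] have "w \<noteq> []" using that by force
    then show ?thesis by (cases w) auto
  qed
  then have "leftmost d" using p(2) by (auto simp: d sorted_wrt_append runs_def)
  ultimately show "d \<in> runs G g (Leaf q)" by (simp add: runs_def)
qed

text \<open>Without a root step, the root symbol and the number of children persist.\<close>

lemma runs_Node_empty:
  assumes "wtgc G" "\<not> (\<tau> = \<sigma> \<and> length gs = length \<zeta>s)"
  shows "runs G (GNode \<tau> gs) (Node \<sigma> \<zeta>s) = {}"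
proof (intro equals0I)
  fix d assume "d \<in> runs G (GNode \<tau> gs) (Node \<sigma> \<zeta>s)"
  then have d: "steps G (Node \<tau> (map emb gs)) d (Node \<tau> (map emb gs)) (Node \<sigma> \<zeta>s)"
    by (simp add: runs_def)
  from this[unfolded steps_Node[OF steps_to_Node_nonroot[OF assms(1) this]]] assms(2)
  show False by auto
qed

text \<open>Joining and projecting are mutually inverse, because the leftmost order leaves no
  freedom in interleaving the runs of the children.\<close>

lemma runs_Node:
  assumes "wtgc G" "length gs = length \<zeta>s"
  shows "bij_betw (join (length \<zeta>s)) (PiE {..<length \<zeta>s} (\<lambda>i. runs G (gs ! i) (\<zeta>s ! i)))
    (runs G (GNode \<sigma> gs) (Node \<sigma> \<zeta>s))"
proof (rule bij_betw_byWitness[where f' = "\<lambda>d. \<lambda>i\<in>{..<length \<zeta>s}. proj (Suc i) d"])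
  let ?n = "length \<zeta>s" and ?F = "PiE {..<length \<zeta>s} (\<lambda>i. runs G (gs ! i) (\<zeta>s ! i))"
  and ?D = "runs G (GNode \<sigma> gs) (Node \<sigma> \<zeta>s)"
  have join_restrict: "join ?n (\<lambda>i\<in>{..<?n}. proj (Suc i) d) = join ?n (\<lambda>i. proj (Suc i) d)" for d :: "(('b, 'a) production \<times> position) list"
    by (rule join_cong) simp
  have D: "(\<forall>(p, w)\<in>set d. \<exists>i<?n. \<exists>v. w = Suc i # v) \<and>
      (\<forall>i<?n. steps G (emb (gs ! i)) (proj (Suc i) d) (emb (gs ! i)) (\<zeta>s ! i)) \<and> leftmost d"
    if "d \<in> ?D" for d
  proof -
    have d: "steps G (Node \<sigma> (map emb gs)) d (Node \<sigma> (map emb gs)) (Node \<sigma> \<zeta>s)" "leftmost d"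
      using that by (simp_all add: runs_def)
    show ?thesis
      using d(1)[unfolded steps_Node[OF steps_to_Node_nonroot[OF assms(1) d(1)]]] assms(2) d(2)
      by auto
  qed
  show "\<forall>f\<in>?F. (\<lambda>i\<in>{..<?n}. proj (Suc i) (join ?n f)) = f"
  proof (intro ballI ext)
    fix f i assume "f \<in> ?F"
    then show "(\<lambda>i\<in>{..<?n}. proj (Suc i) (join ?n f)) i = f i"
      using PiE_arb[of f _ _ i] by (simp add: proj_join restrict_def)
  qed
  show "\<forall>d\<in>?D. join ?n (\<lambda>i\<in>{..<?n}. proj (Suc i) d) = d"
    unfolding join_restrict by (intro ballI join_proj) (use D in blast)+
  show "join ?n ` ?F \<subseteq> ?D"
  proof (intro image_subsetI)
    fix f assume f: "f \<in> ?F"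
    then have fi: "steps G (emb (gs ! i)) (f i) (emb (gs ! i)) (\<zeta>s ! i)" "leftmost (f i)" if "i < ?n" for i
      using that by (auto simp: runs_def PiE_iff)
    have "leftmost (join ?n f)" using fi(2) by (rule leftmost_join)
    moreover have "steps G (Node \<sigma> (map emb gs)) (join ?n f) (Node \<sigma> (map emb gs)) (Node \<sigma> \<zeta>s)"
    proof (subst steps_Node, goal_cases)
      case 1
      show ?case by (auto simp: set_join)
    next
      case 2
      have "\<forall>(p, w)\<in>set (join ?n f). \<exists>i<?n. \<exists>v. w = Suc i # v"
        by (auto simp: set_join)
      then show ?case using fi(1) assms(2) by (simp add: proj_join)
    qed
    ultimately show "join ?n f \<in> ?D" by (simp add: runs_def)
  qed
  show "(\<lambda>d. \<lambda>i\<in>{..<?n}. proj (Suc i) d) ` ?D \<subseteq> ?F"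
  proof (intro image_subsetI)
    fix d assume d: "d \<in> ?D"
    have "proj (Suc i) d \<in> runs G (gs ! i) (\<zeta>s ! i)" if "i < ?n" for i
      using D[OF d] that leftmost_proj[of d] by (simp add: runs_def)
    then show "(\<lambda>i\<in>{..<?n}. proj (Suc i) d) \<in> ?F"
      by (simp only: restrict_PiE_iff lessThan_iff) blast
  qed
qed

lemma finite_runs_Node:
  assumes "wtgc G" "\<And>g \<zeta>. g \<in> set gs \<Longrightarrow> finite (runs G g \<zeta>)"
  shows "finite (runs G (GNode \<tau> gs) (Node \<sigma> \<zeta>s))"
proof (cases "\<tau> = \<sigma> \<and> length gs = length \<zeta>s")
  case True
  then have "finite (PiE {..<length \<zeta>s} (\<lambda>i. runs G (gs ! i) (\<zeta>s ! i)))"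
    using assms(2) by (intro finite_PiE) auto
  then show ?thesis
    using bij_betw_finite[OF runs_Node[OF assms(1), of gs \<zeta>s \<sigma>]] True by simp
qed (simp add: runs_Node_empty[OF assms(1)])

lemma finite_applicable: "wtgc G \<Longrightarrow> finite (applicable G g q)"
  by (rule finite_subset[of _ "productions G"]) (auto simp: applicable_def wtgc_def)

text \<open>Runs to a leaf reduce to runs to left-hand sides of productions. These are nodes, so the
  induction hypothesis for the children applies.\<close>

lemma finite_runs:
  assumes "wtgc G"
  shows "finite (runs G g \<zeta>)"
proof (induction g arbitrary: \<zeta>)
  case (GNode \<tau> gs)
  have N: "finite (runs G (GNode \<tau> gs) (Node \<sigma> \<zeta>s))" for \<sigma> \<zeta>s
    using assms GNode by (rule finite_runs_Node)
  show ?case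
  proof (cases \<zeta>)
    case (Leaf q)
    have "finite (runs G (GNode \<tau> gs) (fst p))" if "p \<in> applicable G (GNode \<tau> gs) q" for p
      using that N production_Leaf[OF assms] by (cases "fst p") (auto simp: applicable_def)
    then show ?thesis
      unfolding Leaf runs_Leaf[OF assms] using finite_applicable[OF assms] by auto
  qed (simp add: N)
qed

section \<open>Weights of runs\<close>

definition run_weight :: "('q, 'f, 's::{comm_semiring_0, comm_monoid_mult}) wtgc \<Rightarrow> 'f gtree \<Rightarrow> ('f, 'q) tree \<Rightarrow> 's" where
  "run_weight G g \<zeta> = (\<Sum>d\<in>runs G g \<zeta>. wt_derivation G d)"

lemma wt_derivation_append: "wt_derivation G (d @ d') = wt_derivation G d * wt_derivation G d'"
  by (simp add: wt_derivation_def)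

lemma wt_derivation_join: "wt_derivation G (join n f) = (\<Prod>i<n. wt_derivation G (f i))"
proof (induction n)
  case (Suc n)
  have "wt_derivation G (shift (Suc n) (f n)) = wt_derivation G (f n)"
    by (simp add: wt_derivation_def shift_def o_def case_prod_unfold)
  then show ?case using Suc by (simp add: wt_derivation_append)
qed (simp add: wt_derivation_def)

lemma run_weight_Leaf:
  assumes "wtgc G"
  shows "run_weight G g (Leaf q) = (\<Sum>p\<in>applicable G g q. wt G p * run_weight G g (fst p))"
proof -
  have "run_weight G g (Leaf q) =
    (\<Sum>(p, d)\<in>Sigma (applicable G g q) (\<lambda>p. runs G g (fst p)). wt_derivation G (d @ [(p, [])]))"
    unfolding run_weight_def runs_Leaf[OF assms]
    by (subst sum.reindex) (auto simp: inj_on_def intro!: sum.cong)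
  also have "\<dots> = (\<Sum>p\<in>applicable G g q. \<Sum>d\<in>runs G g (fst p). wt_derivation G (d @ [(p, [])]))"
    by (rule sum.Sigma[symmetric]) (auto intro: finite_applicable finite_runs assms)
  also have "\<dots> = (\<Sum>p\<in>applicable G g q. wt G p * run_weight G g (fst p))"
    unfolding run_weight_def sum_distrib_left
    by (simp add: wt_derivation_append mult.commute) (simp add: wt_derivation_def)
  finally show ?thesis .
qed

text \<open>The weight of a joined derivation is the product of the weights of its parts, so the sum
  over tuples of runs factors. A mismatch at the root admits no run.\<close>

lemma run_weight_Node:
  assumes "wtgc G"
  shows "run_weight G (GNode \<tau> gs) (Node \<sigma> \<zeta>s) = (if \<tau> = \<sigma> \<and> length gs = length \<zeta>s
    then \<Prod>i<length \<zeta>s. run_weight G (gs ! i) (\<zeta>s ! i) else 0)"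
proof (cases "\<tau> = \<sigma> \<and> length gs = length \<zeta>s")
  case True
  let ?n = "length \<zeta>s"
  have "run_weight G (GNode \<tau> gs) (Node \<sigma> \<zeta>s)
      = (\<Sum>f\<in>PiE {..<?n} (\<lambda>i. runs G (gs ! i) (\<zeta>s ! i)). wt_derivation G (join ?n f))"
    unfolding run_weight_def using True runs_Node[OF assms, of gs \<zeta>s \<sigma>]
    by (intro sum.reindex_bij_betw[symmetric]) auto
  also have "\<dots> = (\<Prod>i<?n. run_weight G (gs ! i) (\<zeta>s ! i))"
    unfolding wt_derivation_join run_weight_def
    by (intro prod_sum_PiE_semiring finite_runs assms finite_lessThan)
  finally show ?thesis using True by simp
next
  case False
  then show ?thesis by (simp only: run_weight_def runs_Node_empty[OF assms False] sum.empty if_False)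
qed

lemma generated_run_weight:
  assumes "wtgc G"
  shows "generated G t = (\<Sum>q\<in>nonterminals G. final_weight G q * run_weight G t (Leaf q))"
proof -
  have "derivations G q t = runs G t (Leaf q)" for q
    by (simp add: derivations_def runs_def)
  then show ?thesis
    using assms by (simp add: generated_def run_weight_def sum_distrib_left sum.Sigma finite_runs wtgc_def)
qed

section \<open>Matching left-hand sides\<close>

fun gsubtree :: "'f gtree \<Rightarrow> position \<Rightarrow> 'f gtree" where
  "gsubtree g [] = g"
| "gsubtree (GNode \<sigma> gs) (i # w) = gsubtree (gs ! (i - 1)) w"

text \<open>Substitution indexed by leaf positions instead of labels, so that equally labelled
  leaves may receive different trees.\<close>

fun fill :: "('f, 'z) tree \<Rightarrow> (position \<Rightarrow> 'f gtree) \<Rightarrow> 'f gtree" where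
  "fill (Leaf z) f = f []"
| "fill (Node \<sigma> ts) f = GNode \<sigma> (map (\<lambda>i. fill (ts ! i) (\<lambda>w. f (Suc i # w))) [0..<length ts])"

text \<open>Expresses that \<open>g\<close> has the shape of \<open>l\<close> above the leaves:
  cutting \<open>g\<close> at these leaves and filling the pieces in again restores it.\<close>

definition matches :: "('f, 'z) tree \<Rightarrow> 'f gtree \<Rightarrow> bool" where
  "matches l g \<longleftrightarrow> fill l (gsubtree g) = g"

lemma matches_Leaf [simp]: "matches (Leaf z) g"
  by (simp add: matches_def)

lemma matches_Node:
  "matches (Node \<sigma> ls) (GNode \<tau> gs) \<longleftrightarrow>
    \<tau> = \<sigma> \<and> length gs = length ls \<and> (\<forall>i<length ls. matches (ls ! i) (gs ! i))"
proof -
  have "matches (Node \<sigma> ls) (GNode \<tau> gs) \<longleftrightarrow>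
      \<sigma> = \<tau> \<and> map (\<lambda>i. fill (ls ! i) (gsubtree (gs ! i))) [0..<length ls] = gs"
    by (simp only: matches_def fill.simps gtree.inject gsubtree.simps diff_Suc_1)
  also have "map (\<lambda>i. fill (ls ! i) (gsubtree (gs ! i))) [0..<length ls] = gs \<longleftrightarrow>
      length gs = length ls \<and> (\<forall>i<length ls. matches (ls ! i) (gs ! i))"
    unfolding list_eq_iff_nth_eq[of "map _ _"] matches_def by auto
  finally show ?thesis by blast
qed

lemma matchesE:
  assumes "matches (Node \<sigma> ls) g"
  obtains gs where "g = GNode \<sigma> gs" "length gs = length ls" "\<And>i. i < length ls \<Longrightarrow> matches (ls ! i) (gs ! i)"
  using assms by (cases g) (auto simp: matches_Node)

lemma leaf_posE:
  assumes "v \<in> leaf_pos (Node \<sigma> ls)"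
  obtains i w where "v = Suc i # w" "i < length ls" "w \<in> leaf_pos (ls ! i)"
  using assms unfolding leaf_pos_Node by blast

lemma fill_cong:
  assumes "\<And>v. v \<in> leaf_pos l \<Longrightarrow> f v = f' v"
  shows "fill l f = fill l f'"
  using assms
proof (induction l arbitrary: f f')
  case (Node \<sigma> ls)
  have "fill (ls ! i) (\<lambda>w. f (Suc i # w)) = fill (ls ! i) (\<lambda>w. f' (Suc i # w))" if "i < length ls" for i
    using that by (intro Node.IH Node.prems) (auto simp only: leaf_pos_Node nth_mem)
  then show ?case by simp
qed simp

lemma gsubtree_fill: "v \<in> leaf_pos l \<Longrightarrow> gsubtree (fill l f) v = f v"
proof (induction l arbitrary: f v)
  case (Node \<sigma> ls)
  obtain i w where v: "v = Suc i # w" "i < length ls" "w \<in> leaf_pos (ls ! i)"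
    using Node.prems by (rule leaf_posE)
  from Node.IH[OF nth_mem[OF v(2)] v(3)] show ?case using v(1,2) by simp
qed simp

lemma matches_fill: "matches l (fill l f)"
  unfolding matches_def by (rule fill_cong) (rule gsubtree_fill)

lemma subtree_emb:
  fixes g :: "'f gtree"
  defines "t \<equiv> emb g :: ('f, 'y) tree"
  assumes "matches l g" "v \<in> leaf_pos l"
  shows "v \<in> pos t" "subtree t v = emb (gsubtree g v)"
proof -
  have "v \<in> pos (emb g :: ('f, 'y) tree) \<and> subtree (emb g :: ('f, 'y) tree) v = emb (gsubtree g v)"
    using assms(2,3)
  proof (induction l arbitrary: g v)
    case (Leaf z)
    then show ?case by (cases g) simp
  next
    case (Node \<sigma> ls)
    obtain gs where g: "g = GNode \<sigma> gs" "length gs = length ls" "\<And>i. i < length ls \<Longrightarrow> matches (ls ! i) (gs ! i)"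
      using Node.prems(1) by (rule matchesE) blast
    obtain i w where v: "v = Suc i # w" "i < length ls" "w \<in> leaf_pos (ls ! i)"
      using Node.prems(2) by (rule leaf_posE)
    from Node.IH[OF nth_mem[OF v(2)] g(3)[OF v(2)] v(3)] show ?case using g(1,2) v(1,2) by simp
  qed
  then show "v \<in> pos t" "subtree t v = emb (gsubtree g v)" by (simp_all add: t_def)
qed

lemma relabel_fill: "relabel \<pi> (fill l f) = fill (map_tree \<pi> a l) (\<lambda>v. relabel \<pi> (f v))"
  by (induction l f arbitrary: a rule: fill.induct) auto

lemma gsubtree_relabel:
  assumes "matches l g" "v \<in> leaf_pos l"
  shows "gsubtree (relabel \<pi> g) v = relabel \<pi> (gsubtree g v)"
proof -
  have "gsubtree (relabel \<pi> g) v = gsubtree (relabel \<pi> (fill l (gsubtree g))) v"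
    using assms(1) by (simp add: matches_def)
  also have "\<dots> = relabel \<pi> (gsubtree g v)"
    \<comment> \<open>Any new leaf labels would do here; the unit value fixes a choice.\<close>
    unfolding relabel_fill[of \<pi> l "gsubtree g" "\<lambda>_. ()"]
    using assms(2) by (simp add: gsubtree_fill leaf_list_map_tree)
  finally show ?thesis .
qed

lemma matches_relabel:
  assumes "matches l g"
  shows "matches (map_tree \<pi> a l) (relabel \<pi> g)"
proof -
  have "relabel \<pi> g = fill (map_tree \<pi> a l) (\<lambda>v. relabel \<pi> (gsubtree g v))"
    using relabel_fill[of \<pi> l "gsubtree g" a] assms by (simp add: matches_def)
  then show ?thesis using matches_fill by metis
qed

lemma fill_in_gtrees:
  assumes "l \<in> trees \<Sigma> Z" "\<And>v. v \<in> leaf_pos l \<Longrightarrow> f v \<in> gtrees \<Sigma>"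
  shows "fill l f \<in> gtrees \<Sigma>"
  using assms
proof (induction arbitrary: f)
  case (Node \<sigma> ts)
  have "fill (ts ! i) (\<lambda>w. f (Suc i # w)) \<in> gtrees \<Sigma>" if "i < length ts" for i
    using that by (intro Node.IH Node.prems) auto
  then show ?case using Node.hyps by (auto intro!: gtrees.GNode)
qed simp

lemma gsubtree_in_gtrees:
  assumes "matches l g" "g \<in> gtrees \<Sigma>" "v \<in> leaf_pos l"
  shows "gsubtree g v \<in> gtrees \<Sigma>"
  using assms
proof (induction l arbitrary: g v)
  case (Node \<sigma> ls)
  obtain gs where g: "g = GNode \<sigma> gs" "length gs = length ls" "\<And>i. i < length ls \<Longrightarrow> matches (ls ! i) (gs ! i)"
    using Node.prems(1) by (rule matchesE) blast
  obtain i w where v: "v = Suc i # w" "i < length ls" "w \<in> leaf_pos (ls ! i)"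
    using Node.prems(3) by (rule leaf_posE)
  have "gs ! i \<in> gtrees \<Sigma>"
    using Node.prems(2) v(2) g(1,2) by (auto elim: gtrees.cases)
  from Node.IH[OF nth_mem[OF v(2)] g(3)[OF v(2)] this v(3)] show ?case by (simp add: g(1) v(1))
qed simp

lemma size_gsubtree_le:
  assumes "matches l g" "v \<in> leaf_pos l"
  shows "size (gsubtree g v) \<le> size g"
  using assms
proof (induction l arbitrary: g v)
  case (Node \<sigma> ls)
  obtain gs where g: "g = GNode \<sigma> gs" "length gs = length ls" "\<And>i. i < length ls \<Longrightarrow> matches (ls ! i) (gs ! i)"
    using Node.prems(1) by (rule matchesE) blast
  obtain i w where v: "v = Suc i # w" "i < length ls" "w \<in> leaf_pos (ls ! i)"
    using Node.prems(2) by (rule leaf_posE)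
  have "size (gsubtree (gs ! i) w) \<le> size (gs ! i)"
    by (rule Node.IH[OF nth_mem[OF v(2)] g(3)[OF v(2)] v(3)])
  also have "\<dots> \<le> size_list size gs"
    using v(2) g(2) by (intro size_list_estimation'[of "gs ! i"]) auto
  finally show ?case by (simp add: g(1) v(1))
qed simp

text \<open>Strict because the left-hand side has an inner node at its root. This feeds the
  induction on the size of the relabeled tree.\<close>

lemma size_gsubtree_less:
  assumes "matches (Node \<sigma> ls) g" "v \<in> leaf_pos (Node \<sigma> ls)"
  shows "size (gsubtree g v) < size g"
proof -
  obtain gs where g: "g = GNode \<sigma> gs" "length gs = length ls" "\<And>i. i < length ls \<Longrightarrow> matches (ls ! i) (gs ! i)"
    using assms(1) by (rule matchesE) blast
  obtain i w where v: "v = Suc i # w" "i < length ls" "w \<in> leaf_pos (ls ! i)"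
    using assms(2) by (rule leaf_posE)
  have "size (gsubtree (gs ! i) w) \<le> size (gs ! i)"
    by (rule size_gsubtree_le[OF g(3)[OF v(2)] v(3)])
  also have "\<dots> \<le> size_list size gs"
    using v(2) g(2) by (intro size_list_estimation'[of "gs ! i"]) auto
  finally show ?thesis by (simp add: g(1) v(1))
qed

section \<open>Preimages under the relabeling\<close>

definition preimage :: "'f ranked_alphabet \<Rightarrow> ('f \<Rightarrow> 'g) \<Rightarrow> 'g gtree \<Rightarrow> 'f gtree set" where
  "preimage \<Sigma> \<pi> u = {g \<in> gtrees \<Sigma>. relabel \<pi> g = u}"

lemma finite_preimage:
  assumes "ranked_alphabet \<Sigma>"
  shows "finite (preimage \<Sigma> \<pi> u)"
proof (induction u)
  case (GNode \<tau> us)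
  let ?B = "\<Union>u\<in>set us. preimage \<Sigma> \<pi> u"
  have "preimage \<Sigma> \<pi> (GNode \<tau> us)
      \<subseteq> (\<lambda>(\<sigma>, gs). GNode \<sigma> gs) ` (symbols \<Sigma> \<times> {gs. set gs \<subseteq> ?B \<and> length gs = length us})"
  proof
    fix g assume "g \<in> preimage \<Sigma> \<pi> (GNode \<tau> us)"
    then have "g \<in> gtrees \<Sigma>" "relabel \<pi> g = GNode \<tau> us" by (auto simp: preimage_def)
    then obtain \<sigma> gs where "g = GNode \<sigma> gs" "\<sigma> \<in> symbols \<Sigma>" "\<forall>t\<in>set gs. t \<in> gtrees \<Sigma>" "map (relabel \<pi>) gs = us"
      by (auto elim!: gtrees.cases)
    then show "g \<in> (\<lambda>(\<sigma>, gs). GNode \<sigma> gs) ` (symbols \<Sigma> \<times> {gs. set gs \<subseteq> ?B \<and> length gs = length us})"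
      by (intro image_eqI[of _ _ "(\<sigma>, gs)"]) (auto simp: preimage_def)
  qed
  moreover have "finite {gs. set gs \<subseteq> ?B \<and> length gs = length us}"
    using GNode by (intro finite_lists_length_eq) auto
  ultimately show ?case
    using assms by (auto simp: ranked_alphabet_def intro: finite_subset)
qed

text \<open>The symbols above the leaves are prescribed by \<open>l\<close>, and the subtrees at the
  leaves are free choices among the preimages of the subtrees of \<open>u\<close>. The condition
  \<open>matches l g\<close> excludes preimages of \<open>u\<close> whose upper part merely has the
  same image as \<open>l\<close>.\<close>

lemma bij_betw_preimage:
  assumes l: "l \<in> trees \<Sigma> Z" and u: "matches (map_tree \<pi> a l) u"
  shows "bij_betw (fill l) (PiE (leaf_pos l) (\<lambda>v. preimage \<Sigma> \<pi> (gsubtree u v)))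
    {g \<in> preimage \<Sigma> \<pi> u. matches l g}"
proof (rule bij_betw_byWitness[where f' = "\<lambda>g. restrict (gsubtree g) (leaf_pos l)"])
  let ?F = "PiE (leaf_pos l) (\<lambda>v. preimage \<Sigma> \<pi> (gsubtree u v))"
  show "\<forall>f\<in>?F. restrict (gsubtree (fill l f)) (leaf_pos l) = f"
  proof (intro ballI ext)
    fix f v assume "f \<in> ?F"
    then show "restrict (gsubtree (fill l f)) (leaf_pos l) v = f v"
      using PiE_arb[of f _ _ v] gsubtree_fill[of v l f] by (simp add: restrict_def)
  qed
  show "\<forall>g\<in>{g \<in> preimage \<Sigma> \<pi> u. matches l g}. fill l (restrict (gsubtree g) (leaf_pos l)) = g"
  proof
    fix g assume "g \<in> {g \<in> preimage \<Sigma> \<pi> u. matches l g}"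
    then have "fill l (gsubtree g) = g" by (simp add: matches_def)
    moreover have "fill l (restrict (gsubtree g) (leaf_pos l)) = fill l (gsubtree g)"
      by (rule fill_cong) simp
    ultimately show "fill l (restrict (gsubtree g) (leaf_pos l)) = g" by simp
  qed
  show "fill l ` ?F \<subseteq> {g \<in> preimage \<Sigma> \<pi> u. matches l g}"
  proof (intro image_subsetI)
    fix f assume "f \<in> ?F"
    then have f: "f v \<in> gtrees \<Sigma>" "relabel \<pi> (f v) = gsubtree u v" if "v \<in> leaf_pos l" for v
      using PiE_mem[of f _ _ v] that by (auto simp: preimage_def)
    have "relabel \<pi> (fill l f) = fill (map_tree \<pi> a l) (\<lambda>v. relabel \<pi> (f v))" by (rule relabel_fill)
    also have "\<dots> = fill (map_tree \<pi> a l) (gsubtree u)"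
      by (rule fill_cong) (simp add: leaf_list_map_tree f(2))
    also have "\<dots> = u" using u by (simp add: matches_def)
    finally show "fill l f \<in> {g \<in> preimage \<Sigma> \<pi> u. matches l g}"
      using fill_in_gtrees[OF l f(1)] matches_fill by (simp add: preimage_def)
  qed
  show "(\<lambda>g. restrict (gsubtree g) (leaf_pos l)) ` {g \<in> preimage \<Sigma> \<pi> u. matches l g} \<subseteq> ?F"
  proof (intro image_subsetI)
    fix g assume "g \<in> {g \<in> preimage \<Sigma> \<pi> u. matches l g}"
    then have g: "g \<in> gtrees \<Sigma>" "relabel \<pi> g = u" "matches l g" by (auto simp: preimage_def)
    then show "restrict (gsubtree g) (leaf_pos l) \<in> ?F"
      unfolding restrict_PiE_iff
      using gsubtree_in_gtrees[OF g(3,1)] gsubtree_relabel[OF g(3), of _ \<pi>] by (simp add: preimage_def)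
  qed
qed

section \<open>Run weights as sums over productions\<close>

lemma prod_eq_0:
  fixes f :: "'a \<Rightarrow> 's::{comm_semiring_0, comm_monoid_mult}"
  assumes "finite A" "x \<in> A" "f x = 0"
  shows "prod f A = 0"
  using prod.remove[OF assms(1,2), of f] assms(3) by simp

lemma prod_leaf_pos_Node:
  "(\<Prod>v\<in>leaf_pos (Node \<sigma> ls). f v) = (\<Prod>i<length ls. \<Prod>v\<in>leaf_pos (ls ! i). f (Suc i # v))"
proof -
  have "(\<Prod>v\<in>leaf_pos (Node \<sigma> ls). f v) = (\<Prod>i<length ls. \<Prod>v\<in>(#) (Suc i) ` leaf_pos (ls ! i). f v)"
    unfolding leaf_pos_Node by (rule prod.UNION_disjoint) auto
  also have "\<dots> = (\<Prod>i<length ls. \<Prod>v\<in>leaf_pos (ls ! i). f (Suc i # v))"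
    by (rule prod.cong[OF refl], subst prod.reindex) simp_all
  finally show ?thesis .
qed

text \<open>A run to \<open>l\<close> keeps all symbols above its leaves and splits into independent
  runs at the leaf positions.\<close>

lemma run_weight_matches:
  assumes "wtgc G"
  shows "run_weight G g l = (if matches l g
    then \<Prod>v\<in>leaf_pos l. run_weight G (gsubtree g v) (Leaf (leaf_label l v)) else 0)"
proof (induction l arbitrary: g)
  case (Node \<sigma> ls)
  obtain \<tau> gs where g: "g = GNode \<tau> gs" by (cases g)
  show ?case
  proof (cases "\<tau> = \<sigma> \<and> length gs = length ls")
    case head: True
    have eq: "run_weight G g (Node \<sigma> ls) = (\<Prod>i<length ls. run_weight G (gs ! i) (ls ! i))"
      using head by (simp add: g run_weight_Node[OF assms])
    show ?thesis
    proof (cases "\<forall>i<length ls. matches (ls ! i) (gs ! i)")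
      case True
      then have "(\<Prod>i<length ls. run_weight G (gs ! i) (ls ! i)) = (\<Prod>i<length ls. \<Prod>v\<in>leaf_pos (ls ! i).
          run_weight G (gsubtree (gs ! i) v) (Leaf (leaf_label (ls ! i) v)))"
        by (intro prod.cong refl) (simp add: Node.IH)
      then show ?thesis
        unfolding eq prod_leaf_pos_Node using True head by (simp add: g matches_Node)
    next
      case False
      then obtain i where "i < length ls" "\<not> matches (ls ! i) (gs ! i)" by blast
      then have "(\<Prod>i<length ls. run_weight G (gs ! i) (ls ! i)) = 0"
        by (intro prod_eq_0[of _ i]) (simp_all add: Node.IH)
      then show ?thesis unfolding eq using False by (auto simp: g matches_Node)
    qed
  next
    case False
    then show ?thesis by (auto simp: g matches_Node run_weight_Node[OF assms])
  qed
qed simp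

text \<open>Faithful to the satisfaction of \<open>E\<close> on trees matching the left-hand side,
  where all constrained positions exist; on other trees the run weight is 0 anyway.\<close>

definition obeys :: "constraints \<Rightarrow> 'f gtree \<Rightarrow> bool" where
  "obeys E g \<longleftrightarrow> (\<forall>(v, w)\<in>E. gsubtree g v = gsubtree g w)"

abbreviation target :: "('f, 'q) production \<Rightarrow> 'q" where
  "target p \<equiv> fst (snd p)"

abbreviation equalities :: "('f, 'q) production \<Rightarrow> constraints" where
  "equalities p \<equiv> fst (snd (snd p))"

lemma satisfies_emb:
  fixes g :: "'f gtree"
  assumes "matches l g" "v \<in> leaf_pos l" "w \<in> leaf_pos l"
  shows "satisfies (emb g :: ('f, 'y) tree) (v, w) \<longleftrightarrow> gsubtree g v = gsubtree g w"
  unfolding satisfies_def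
  using subtree_emb[OF assms(1,2), where ?'y = 'y] subtree_emb[OF assms(1,3), where ?'y = 'y]
  by (simp add: emb_inject)

text \<open>The index set no longer depends on \<open>g\<close>, which allows swapping this sum with
  the sum over the preimages. Where \<open>obeys\<close> and applicability may differ, the tree does
  not match and both terms vanish.\<close>

lemma run_weight_Leaf_obeys:
  assumes G: "wtgc G" "positive G" "classic G"
  shows "run_weight G g (Leaf q) = (\<Sum>p\<in>{p \<in> productions G. target p = q}.
    wt G p * (if obeys (equalities p) g then run_weight G g (fst p) else 0))"
  unfolding run_weight_Leaf[OF G(1)]
proof (rule sum.mono_neutral_cong_left)
  show "finite {p \<in> productions G. target p = q}" using G(1) by (simp add: wtgc_def)
  show "applicable G g q \<subseteq> {p \<in> productions G. target p = q}" by (auto simp: applicable_def)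
  have *: "(l, q, E, I) \<in> applicable G g q \<longleftrightarrow> obeys E g"
    if p: "(l, q, E, I) \<in> productions G" "matches l g" for l E I
  proof -
    have "I = {}" using G(2) p(1) by (auto simp: positive_def)
    moreover have "satisfies (emb g :: ('b, 'a) tree) e \<longleftrightarrow> (case e of (v, w) \<Rightarrow> gsubtree g v = gsubtree g w)"
      if "e \<in> E" for e
      using that classic_constraints[OF G(3) p(1)] satisfies_emb[OF p(2)] by auto
    ultimately show ?thesis using p(1) by (simp add: applicable_def obeys_def)
  qed
  have weight: "wt G p * (if obeys (equalities p) g then run_weight G g (fst p) else 0) =
      (if p \<in> applicable G g q then wt G p * run_weight G g (fst p) else 0)"
    if p: "p \<in> productions G" "target p = q" for p
  proof (cases "matches (fst p) g")
    case True
    obtain l E I where "p = (l, q, E, I)" using p(2) by (cases p) auto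
    then show ?thesis using *[of l E I] p(1) True by simp
  qed (simp add: run_weight_matches[OF G(1)])
  show "\<forall>p\<in>{p \<in> productions G. target p = q} - applicable G g q.
    wt G p * (if obeys (equalities p) g then run_weight G g (fst p) else 0) = 0"
    by (simp add: weight)
  show "wt G p * run_weight G g (fst p) =
      wt G p * (if obeys (equalities p) g then run_weight G g (fst p) else 0)"
    if "p \<in> applicable G g q" for p
  proof -
    have "p \<in> productions G" "target p = q" using that by (auto simp: applicable_def)
    from weight[OF this] that show ?thesis by simp
  qed
qed

text \<open>Exactly one sink production fits the root symbol. It has weight 1, and so do the
  subtrees by induction.\<close>

lemma run_weight_sink:
  assumes G: "wtgc G" "sink G b" and "g \<in> gtrees (alphabet G)"
  shows "run_weight G g (Leaf b) = 1"
  using assms(3)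
proof induction
  case (GNode \<sigma> gs)
  let ?p = "\<lambda>\<sigma>. (Node \<sigma> (replicate (rk (alphabet G) \<sigma>) (Leaf b)), b, {} :: constraints, {} :: constraints)"
  have P: "{(l, q, E, I) \<in> productions G. q = b} = ?p ` symbols (alphabet G)"
    and wt1: "\<And>l E I. (l, b, E, I) \<in> productions G \<Longrightarrow> wt G (l, b, E, I) = 1"
    using G(2) by (auto simp: sink_def)
  have app: "applicable G (GNode \<sigma> gs) b = ?p ` symbols (alphabet G)"
  proof (intro equalityI subsetI)
    fix p assume "p \<in> applicable G (GNode \<sigma> gs) b"
    then show "p \<in> ?p ` symbols (alphabet G)"
      unfolding P[symmetric] by (auto simp: applicable_def)
  next
    fix p assume p: "p \<in> ?p ` symbols (alphabet G)"
    then have "p \<in> {(l, q, E, I) \<in> productions G. q = b}" unfolding P .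
    then show "p \<in> applicable G (GNode \<sigma> gs) b" using p by (auto simp: applicable_def)
  qed
  have fin: "finite (symbols (alphabet G))" using G(1) by (simp add: wtgc_def ranked_alphabet_def)
  have wt: "wt G (?p \<tau>) = 1" if "\<tau> \<in> symbols (alphabet G)" for \<tau>
  proof -
    have "?p \<tau> \<in> {(l, q, E, I) \<in> productions G. q = b}" unfolding P using that by blast
    then show ?thesis by (intro wt1) simp
  qed
  have "run_weight G (GNode \<sigma> gs) (Leaf b)
      = (\<Sum>\<tau>\<in>symbols (alphabet G). wt G (?p \<tau>) * run_weight G (GNode \<sigma> gs) (fst (?p \<tau>)))"
    unfolding run_weight_Leaf[OF G(1)] app by (subst sum.reindex) (auto simp: inj_on_def)
  also have "\<dots> = (\<Sum>\<tau>\<in>symbols (alphabet G). if \<tau> = \<sigma> then 1 else 0)"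
  proof (intro sum.cong refl)
    fix \<tau> assume "\<tau> \<in> symbols (alphabet G)"
    have "run_weight G (GNode \<sigma> gs) (Node \<tau> (replicate (rk (alphabet G) \<tau>) (Leaf b))) = (if \<tau> = \<sigma> then 1 else 0)"
      using GNode by (auto simp: run_weight_Node[OF G(1)])
    then show "wt G (?p \<tau>) * run_weight G (GNode \<sigma> gs) (fst (?p \<tau>)) = (if \<tau> = \<sigma> then 1 else 0)"
      using wt[OF \<open>\<tau> \<in> symbols (alphabet G)\<close>] by simp
  qed
  also have "\<dots> = 1" using fin GNode(1) by simp
  finally show ?case .
qed

lemma equiv_imp_sym: "equiv A R \<Longrightarrow> (x, y) \<in> R \<Longrightarrow> (y, x) \<in> R"
  by (auto simp: equiv_def dest: symD)

lemma equiv_imp_refl: "equiv A R \<Longrightarrow> x \<in> A \<Longrightarrow> (x, x) \<in> R"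
  by (auto simp: equiv_def refl_on_def)

lemma preimage_subset_gtrees: "g \<in> preimage \<Sigma> \<pi> u \<Longrightarrow> g \<in> gtrees \<Sigma>"
  by (simp add: preimage_def)

section \<open>The relabeled grammar\<close>

text \<open>The coding \<open>h\<close> of the nonterminals avoids 0, which is thus available as the
  fresh sink.\<close>

locale relabeled_grammar =
  fixes G :: "('q, 'f, 's::{comm_semiring_0, comm_monoid_mult}) wtgc"
    and \<Delta> :: "'g ranked_alphabet" and \<pi> :: "'f \<Rightarrow> 'g" and b :: 'q and h :: "'q \<Rightarrow> nat"
  assumes wtgc: "wtgc G" and positive: "positive G" and classic: "classic G" and sink: "sink G b"
    and class_condition: "\<And>l q E I. (l, q, E, I) \<in> productions G \<Longrightarrow> class_condition l E b (nonterminals G)"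
    and ranked: "ranked_alphabet \<Delta>" and relabeling: "relabeling (alphabet G) \<Delta> \<pi>"
    and inj: "inj_on h (nonterminals G)" and h_nonzero: "\<And>q. h q \<noteq> 0"
begin

text \<open>If the class has a second member, the choice of a preimage is made at its weighted
  member, and a \<open>b\<close> must not sum over choices again. A \<open>b\<close> alone in its
  class is the only place where they are summed.\<close>

definition new_label :: "('f, 'q) tree \<Rightarrow> constraints \<Rightarrow> position \<Rightarrow> nat" where
  "new_label l E v = (if leaf_label l v = b \<and> (\<exists>w. w \<noteq> v \<and> (v, w) \<in> hull_on (leaf_pos l) E)
    then 0 else h (leaf_label l v))"

fun new_production :: "('f, 'q) production \<Rightarrow> ('g, nat) production" where
  "new_production (l, q, E, I) = (map_tree \<pi> (new_label l E) l, h q, E, {})"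

definition sink_productions :: "('g, nat) production set" where
  "sink_productions = (\<lambda>\<delta>. (Node \<delta> (replicate (rk \<Delta> \<delta>) (Leaf 0)), 0, {}, {})) ` symbols \<Delta>"

text \<open>Several productions of \<open>G\<close> may have the same image, so weights are summed
  over the fibre. As \<open>h\<close> avoids 0, the target separates these images from the
  productions of the fresh sink.\<close>

definition new_grammar :: "(nat, 'g, 's) wtgc" where
  "new_grammar = \<lparr>nonterminals = insert 0 (h ` nonterminals G), alphabet = \<Delta>,
    final_weight = (\<lambda>n. if n = 0 then 0 else final_weight G (inv_into (nonterminals G) h n)),
    productions = new_production ` productions G \<union> sink_productions,
    wt = (\<lambda>p. if target p = 0 then 1 else \<Sum>r\<in>{r \<in> productions G. new_production r = p}. wt G r)\<rparr>"

section \<open>Well-formedness and eq-restriction of the relabeled grammar\<close>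

abbreviation N where "N \<equiv> nonterminals G"

lemma finite_productions: "finite (productions G)"
  using wtgc by (simp add: wtgc_def)

lemma finite_preimage_alphabet: "finite (preimage (alphabet G) \<pi> u)"
  using wtgc by (intro finite_preimage) (simp add: wtgc_def)

lemma production_cases:
  assumes "p' \<in> productions new_grammar"
  obtains (new) l q E I where "(l, q, E, I) \<in> productions G" "p' = (map_tree \<pi> (new_label l E) l, h q, E, {})"
  | (sink) \<delta> where "\<delta> \<in> symbols \<Delta>" "p' = (Node \<delta> (replicate (rk \<Delta> \<delta>) (Leaf 0)), 0, {}, {})"
  using assms by (auto simp: new_grammar_def sink_productions_def)

lemma new_label_in:
  assumes "(l, q, E, I) \<in> productions G" "v \<in> leaf_pos l"
  shows "new_label l E v \<in> insert 0 (h ` N)"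
  using leaf_label_in[OF wtgc_production(1)[OF wtgc assms(1)] assms(2)] by (simp add: new_label_def)

lemma production_Node:
  assumes "(l, q, E, I) \<in> productions G"
  obtains \<sigma> ls where "l = Node \<sigma> ls"
  using assms production_Leaf[OF wtgc] by (cases l) auto

lemma wtgc_new_grammar: "wtgc new_grammar"
  unfolding wtgc_def
proof (intro conjI)
  show "finite (nonterminals new_grammar)" "ranked_alphabet (alphabet new_grammar)"
    "finite (productions new_grammar)"
    using wtgc ranked by (simp_all add: wtgc_def ranked_alphabet_def new_grammar_def sink_productions_def)
  have "case p of (l, q, E, I) \<Rightarrow>
      l \<in> trees (alphabet new_grammar) (nonterminals new_grammar) - Leaf ` nonterminals new_grammar \<and>
      q \<in> nonterminals new_grammar \<and> finite E \<and> finite I"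
    if "p \<in> productions new_grammar" for p
    using that
  proof (cases rule: production_cases)
    case (new l q E I)
    obtain \<sigma> ls where l: "l = Node \<sigma> ls" using new(1) by (rule production_Node)
    have "map_tree \<pi> (new_label l E) l \<in> trees \<Delta> (insert 0 (h ` N))"
      using wtgc_production(1)[OF wtgc new(1)] relabeling new_label_in[OF new(1)] by (rule map_tree_in_trees)
    moreover have "map_tree \<pi> (new_label l E) l \<notin> Leaf ` insert 0 (h ` N)"
      unfolding l by auto
    ultimately show ?thesis
      using wtgc_production(3,4)[OF wtgc new(1)] by (simp add: new(2) new_grammar_def)
  next
    case (sink \<delta>)
    have "Node \<delta> (replicate (rk \<Delta> \<delta>) (Leaf 0)) \<in> trees \<Delta> (insert 0 (h ` N))"
      using sink(1) by (auto intro!: trees.intros)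
    then show ?thesis by (auto simp: sink(2) new_grammar_def)
  qed
  then show "\<forall>(l, q, E, I)\<in>productions new_grammar.
      l \<in> trees (alphabet new_grammar) (nonterminals new_grammar) - Leaf ` nonterminals new_grammar \<and>
      q \<in> nonterminals new_grammar \<and> finite E \<and> finite I" by blast
qed

lemma positive_new_grammar: "positive new_grammar"
  by (auto simp: positive_def new_grammar_def sink_productions_def)

lemma classic_new_grammar: "classic new_grammar"
  unfolding classic_def
proof
  fix p assume "p \<in> productions new_grammar"
  then show "case p of (l, q, E, I) \<Rightarrow> \<forall>(v, v')\<in>E \<union> I.
    v \<in> pos_labelled (Inr ` nonterminals new_grammar) l \<and> v' \<in> pos_labelled (Inr ` nonterminals new_grammar) l"
  proof (cases rule: production_cases)
    case (new l q E I)
    have "v \<in> pos_labelled (Inr ` nonterminals new_grammar) (map_tree \<pi> (new_label l E) l)"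
      if "v \<in> leaf_pos l" for v
      using that new_label_in[OF new(1) that]
      by (subst pos_labelled_Inr) (simp add: leaf_list_map_tree leaf_label_map_tree new_grammar_def)
    then show ?thesis using classic_constraints[OF classic new(1)] by (auto simp: new(2))
  qed simp
qed

lemma sink_new_grammar: "sink new_grammar 0"
  by (auto simp: sink_def new_grammar_def sink_productions_def h_nonzero)

text \<open>In a singleton class the only leaf keeps its label, even if it is \<open>b\<close>. In a
  larger class the distinguished label differs from \<open>b\<close>, so its unique bearer keeps it
  and all other members turn into the fresh sink.\<close>

lemma new_label_class:
  assumes p: "(l, q, E, I) \<in> productions G" and v: "v \<in> leaf_pos l"
  obtains w where "(v, w) \<in> hull_on (leaf_pos l) E" "new_label l E w = h (leaf_label l w)"
    "\<And>w'. (v, w') \<in> hull_on (leaf_pos l) E \<Longrightarrow> w' \<noteq> w \<Longrightarrow> leaf_label l w' = b \<and> new_label l E w' = 0"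
proof -
  let ?H = "hull_on (leaf_pos l) E"
  have H: "equiv (leaf_pos l) ?H"
    by (rule equiv_hull_on[OF classic_constraints[OF classic p]])
  show ?thesis
  proof (cases "\<exists>w. w \<noteq> v \<and> (v, w) \<in> ?H")
    case False
    then have *: "w' = v" if "(v, w') \<in> ?H" for w' using that by blast
    show ?thesis
    proof (rule that)
      show "(v, v) \<in> ?H" using H v by (rule equiv_imp_refl)
      show "new_label l E v = h (leaf_label l v)" unfolding new_label_def using False by (simp only: simp_thms if_False)
    qed (use * in blast)
  next
    case True
    then obtain u where u: "u \<noteq> v" "(v, u) \<in> ?H" by blast
    \<comment> \<open>\<open>new_label\<close> looks for a second member relative to
      \<open>w\<close> itself, so one is supplied for every member of the class.\<close>
    have nonsingleton: "\<exists>x. x \<noteq> w \<and> (w, x) \<in> ?H" if "(v, w) \<in> ?H" for w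
    proof (cases "w = v")
      case True
      show ?thesis unfolding True using u by (intro exI[of _ u] conjI)
    next
      case False
      then have "v \<noteq> w" by simp
      then show ?thesis using equiv_imp_sym[OF H that] by (intro exI[of _ v] conjI)
    qed
    from bspec[OF class_condition[OF p, unfolded class_condition_def] v]
    obtain q' where q': "\<forall>w. (v, w) \<in> ?H \<longrightarrow> leaf_label l w \<in> {q', b}"
      "\<exists>!w. (v, w) \<in> ?H \<and> leaf_label l w = q'"
      by (elim bexE conjE)
    from q'(2) obtain w where w: "(v, w) \<in> ?H \<and> leaf_label l w = q'"
      "\<forall>w'. (v, w') \<in> ?H \<and> leaf_label l w' = q' \<longrightarrow> w' = w" by (rule ex1E)
    \<comment> \<open>Otherwise all members would bear \<open>q'\<close>, against its uniqueness,
      since \<open>u\<close> and \<open>v\<close> are two of them.\<close>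
    have "q' \<noteq> b"
    proof
      assume "q' = b"
      then have all: "leaf_label l w' = q'" if "(v, w') \<in> ?H" for w' using q'(1) that by blast
      have "u = w" using w(2) u(2) all[OF u(2)] by simp
      moreover have "v = w" using w(2) equiv_imp_refl[OF H v] all[OF equiv_imp_refl[OF H v]] by simp
      ultimately show False using u(1) by simp
    qed
    show ?thesis
    proof (rule that)
      show "(v, w) \<in> ?H" using w(1) by blast
      show "new_label l E w = h (leaf_label l w)"
        using w(1) \<open>q' \<noteq> b\<close> by (simp add: new_label_def)
      fix w' assume w': "(v, w') \<in> ?H" "w' \<noteq> w"
      then have "leaf_label l w' = b" using q'(1) w(2) by blast
      then show "leaf_label l w' = b \<and> new_label l E w' = 0"
        using nonsingleton[OF w'(1)] by (simp add: new_label_def)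
    qed
  qed
qed

text \<open>The one label kept in a class is nonzero, hence distinct from the fresh sink. In the
  productions of the fresh sink all classes are singletons, and 0 itself serves as the distinguished
  label.\<close>

lemma class_condition_new_grammar:
  assumes "(l, q, E, I) \<in> productions new_grammar"
  shows "class_condition l E 0 (nonterminals new_grammar)"
  using assms
proof (cases rule: production_cases)
  case (new l0 q0 E0 I0)
  then have l: "l = map_tree \<pi> (new_label l0 E0) l0" "E = E0" by auto
  let ?H = "hull_on (leaf_pos l0) E0"
  have inP: "w \<in> leaf_pos l0" if "(v, w) \<in> ?H" for v w
    using that equiv_type[OF equiv_hull_on[OF classic_constraints[OF classic new(1)]]] by auto
  show ?thesis
    unfolding class_condition_def l leaf_list_map_tree
  proof
    fix v assume "v \<in> leaf_pos l0"
    then obtain w where w: "(v, w) \<in> ?H" "new_label l0 E0 w = h (leaf_label l0 w)"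
      "\<And>w'. (v, w') \<in> ?H \<Longrightarrow> w' \<noteq> w \<Longrightarrow> leaf_label l0 w' = b \<and> new_label l0 E0 w' = 0"
      using new_label_class[OF new(1)] by metis
    let ?l = "map_tree \<pi> (new_label l0 E0) l0"
    have lab: "leaf_label ?l w' = (if w' = w then h (leaf_label l0 w) else 0)" if "(v, w') \<in> ?H" for w'
      using w(2) w(3)[OF that] by (simp add: leaf_label_map_tree inP[OF that])
    have "h (leaf_label l0 w) \<in> nonterminals new_grammar"
      using leaf_label_in[OF wtgc_production(1)[OF wtgc new(1)] inP[OF w(1)]] by (simp add: new_grammar_def)
    moreover have "\<forall>w'. (v, w') \<in> ?H \<longrightarrow> leaf_label ?l w' \<in> {h (leaf_label l0 w), 0}"
      using lab by simp
    moreover have "\<exists>!w'. (v, w') \<in> ?H \<and> leaf_label ?l w' = h (leaf_label l0 w)"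
    proof (rule ex1I[of _ w])
      show "(v, w) \<in> ?H \<and> leaf_label ?l w = h (leaf_label l0 w)" using w(1) lab[OF w(1)] by simp
      fix w' assume "(v, w') \<in> ?H \<and> leaf_label ?l w' = h (leaf_label l0 w)"
      then show "w' = w" using lab[of w'] h_nonzero[of "leaf_label l0 w"] by (simp split: if_splits)
    qed
    ultimately show "\<exists>q'\<in>nonterminals new_grammar. (\<forall>w. (v, w) \<in> ?H \<longrightarrow> leaf_label ?l w \<in> {q', 0}) \<and>
        (\<exists>!w. (v, w) \<in> ?H \<and> leaf_label ?l w = q')" by blast
  qed
next
  case (sink \<delta>)
  then have l: "l = Node \<delta> (replicate (rk \<Delta> \<delta>) (Leaf 0))" "E = {}" by auto
  have "equiv (leaf_pos l) (Id_on (leaf_pos l))"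
    by (auto simp: equiv_def refl_on_def sym_def trans_def)
  then have H: "hull_on (leaf_pos l) E \<subseteq> Id_on (leaf_pos l)"
    unfolding l(2) by (rule hull_on_least) simp
  have H': "equiv (leaf_pos l) (hull_on (leaf_pos l) E)" unfolding l(2) by (rule equiv_hull_on) simp
  have lab: "leaf_label l v = 0" if "v \<in> leaf_pos l" for v
    using that unfolding l(1) by (elim leaf_posE) simp
  have "0 \<in> nonterminals new_grammar" by (simp add: new_grammar_def)
  moreover have "(\<forall>w. (v, w) \<in> hull_on (leaf_pos l) E \<longrightarrow> leaf_label l w \<in> {0, 0}) \<and>
    (\<exists>!w. (v, w) \<in> hull_on (leaf_pos l) E \<and> leaf_label l w = 0)" if v: "v \<in> leaf_pos l" for v
  proof -
    have *: "w = v" if "(v, w) \<in> hull_on (leaf_pos l) E" for w using H that by auto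
    show ?thesis
      using * lab[OF v] equiv_imp_refl[OF H' v] by blast
  qed
  ultimately show ?thesis unfolding class_condition_def by blast
qed

lemma eq_restricted_new_grammar: "eq_restricted new_grammar"
  unfolding eq_restricted_iff[OF wtgc_new_grammar classic_new_grammar]
proof (intro exI conjI ballI)
  show "sink new_grammar 0" by (rule sink_new_grammar)
  fix p assume "p \<in> productions new_grammar"
  then show "case p of (l, q, E, I) \<Rightarrow> class_condition l E 0 (nonterminals new_grammar)"
    by (cases p) (simp only: prod.case class_condition_new_grammar)
qed

section \<open>The weight identity between the two grammars\<close>

abbreviation W where "W \<equiv> run_weight G"
abbreviation W' where "W' \<equiv> run_weight new_grammar"
abbreviation pre where "pre \<equiv> preimage (alphabet G) \<pi>"

text \<open>The contribution of one production: a matching preimage is a family of preimages at the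
  leaves, and it obeys \<open>E\<close> iff it is constant on classes. The sum over such families
  factors over the kept leaves, and there the induction hypothesis applies.\<close>

lemma sum_preimage_lhs:
  assumes p: "(l, q, E, I) \<in> productions G" and u: "u \<in> gtrees \<Delta>"
    and IH: "\<And>u' q. size u' < size u \<Longrightarrow> u' \<in> gtrees \<Delta> \<Longrightarrow> q \<in> N \<Longrightarrow>
      W' u' (Leaf (h q)) = (\<Sum>g\<in>pre u'. W g (Leaf q))"
  shows "(\<Sum>g\<in>pre u. if obeys E g then W g l else 0)
    = (if obeys E u then W' u (map_tree \<pi> (new_label l E) l) else 0)"
proof -
  let ?l = "map_tree \<pi> (new_label l E) l" and ?P = "leaf_pos l" and ?H = "hull_on (leaf_pos l) E"
  have l_tree: "l \<in> trees (alphabet G) N" by (rule wtgc_production(1)[OF wtgc p])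
  have EP: "E \<subseteq> ?P \<times> ?P" by (rule classic_constraints[OF classic p])
  have H: "equiv ?P ?H" using EP by (rule equiv_hull_on)
  have "(\<Sum>g\<in>pre u. if obeys E g then W g l else 0) = (\<Sum>g\<in>{g \<in> pre u. matches l g}. if obeys E g then W g l else 0)"
    by (rule sum.mono_neutral_right) (auto simp: finite_preimage_alphabet run_weight_matches[OF wtgc])
  also have "\<dots> = (if obeys E u then W' u ?l else 0)"
  proof (cases "matches ?l u")
    case False
    then have none: "{g \<in> pre u. matches l g} = {}" by (auto simp: preimage_def dest: matches_relabel)
    show ?thesis unfolding none using False by (simp add: run_weight_matches[OF wtgc_new_grammar])
  next
    case True
    let ?F = "PiE ?P (\<lambda>v. pre (gsubtree u v))"
    have obeys_fill: "obeys E (fill l f) \<longleftrightarrow> (\<forall>(v, w)\<in>?H. f v = f w)" for f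
    proof -
      have "obeys E (fill l f) \<longleftrightarrow> (\<forall>(v, w)\<in>E. f v = f w)"
        unfolding obeys_def using EP by (intro ball_cong refl) (auto simp: gsubtree_fill)
      then show ?thesis unfolding hull_on_ball_eq_iff[OF EP] .
    qed
    have W_fill: "W (fill l f) l = (\<Prod>v\<in>?P. W (f v) (Leaf (leaf_label l v)))" for f
      by (simp add: run_weight_matches[OF wtgc, of _ l] matches_fill gsubtree_fill)
    have "(\<Sum>g\<in>{g \<in> pre u. matches l g}. if obeys E g then W g l else 0)
        = (\<Sum>f\<in>?F. if obeys E (fill l f) then W (fill l f) l else 0)"
      by (rule sum.reindex_bij_betw[OF bij_betw_preimage[OF l_tree True], symmetric])
    also have "\<dots> = (\<Sum>f\<in>{f \<in> ?F. \<forall>(v, w)\<in>?H. f v = f w}. \<Prod>v\<in>?P. W (f v) (Leaf (leaf_label l v)))"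
      unfolding obeys_fill W_fill
      by (rule sum.inter_filter[symmetric]) (simp add: finite_PiE finite_preimage_alphabet)
    also have "\<dots> = (if obeys E u then W' u ?l else 0)"
    proof (cases "obeys E u")
      case False
      \<comment> \<open>Equal subtrees have equal images, so if \<open>u\<close> violates a
        constraint, every preimage does.\<close>
      have "{f \<in> ?F. \<forall>(v, w)\<in>?H. f v = f w} = {}"
      proof (rule equals0I)
        fix f assume f: "f \<in> {f \<in> ?F. \<forall>(v, w)\<in>?H. f v = f w}"
        have "gsubtree u v = gsubtree u w" if "(v, w) \<in> E" for v w
        proof -
          have "v \<in> ?P" "w \<in> ?P" using that EP by auto
          then have "relabel \<pi> (f v) = gsubtree u v" "relabel \<pi> (f w) = gsubtree u w"
            using f PiE_mem[of f ?P] by (auto simp: preimage_def)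
          moreover have "f v = f w" using f that subset_hull_on[of E ?P] by blast
          ultimately show ?thesis by simp
        qed
        then show False using False by (auto simp: obeys_def)
      qed
      then show ?thesis using False by (simp only: sum.empty if_False)
    next
      case obeys: True
      \<comment> \<open>The leaves that keep their label; by \<open>new_label_class\<close> they
        form a transversal of the constraint classes.\<close>
      define T where "T = {v \<in> ?P. new_label l E v \<noteq> 0}"
      obtain \<sigma> ls where l: "l = Node \<sigma> ls" using p by (rule production_Node)
      have u_sub: "gsubtree u v \<in> gtrees \<Delta>" "size (gsubtree u v) < size u" if "v \<in> ?P" for v
      proof -
        have v: "v \<in> leaf_pos ?l" using that by (simp only: leaf_list_map_tree)
        show "gsubtree u v \<in> gtrees \<Delta>" using True u v by (rule gsubtree_in_gtrees)
        show "size (gsubtree u v) < size u"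
          using True v unfolding l map_tree.simps by (rule size_gsubtree_less)
      qed
      have inP: "w \<in> ?P" if "(v, w) \<in> ?H" for v w using that equiv_type[OF H] by auto
      have label0: "leaf_label l v = b" if "v \<in> ?P - T" for v
        using that by (auto simp: T_def new_label_def h_nonzero split: if_splits)
      have label_T: "new_label l E v = h (leaf_label l v)" if "v \<in> T" for v
        using that by (auto simp: T_def new_label_def split: if_splits)
      have "(\<Sum>f\<in>{f \<in> ?F. \<forall>(v, w)\<in>?H. f v = f w}. \<Prod>v\<in>?P. W (f v) (Leaf (leaf_label l v)))
          = (\<Prod>v\<in>T. \<Sum>g\<in>pre (gsubtree u v). W g (Leaf (leaf_label l v)))"
      proof (rule sum_constant_on_classes[OF _ H])
        show "T \<subseteq> ?P" by (auto simp: T_def)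
        show "finite (pre (gsubtree u v))" for v by (rule finite_preimage_alphabet)
        \<comment> \<open>Since \<open>u\<close> obeys \<open>E\<close>, its subtrees agree along
          each class.\<close>
        show "pre (gsubtree u v) = pre (gsubtree u w)" if "(v, w) \<in> ?H" for v w
        proof -
          have "\<forall>(v, w)\<in>?H. gsubtree u v = gsubtree u w"
            unfolding hull_on_ball_eq_iff[OF EP] using obeys by (simp add: obeys_def)
          then show ?thesis using that by auto
        qed
        show "W g (Leaf (leaf_label l v)) = 1" if "v \<in> ?P - T" "g \<in> pre (gsubtree u v)" for v g
          using run_weight_sink[OF wtgc sink] preimage_subset_gtrees[OF that(2)] label0[OF that(1)] by simp
        show "\<exists>!w. w \<in> T \<and> (v, w) \<in> ?H" if v: "v \<in> ?P" for v
        proof -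
          obtain w where w: "(v, w) \<in> ?H" "new_label l E w = h (leaf_label l w)"
            "\<And>w'. (v, w') \<in> ?H \<Longrightarrow> w' \<noteq> w \<Longrightarrow> leaf_label l w' = b \<and> new_label l E w' = 0"
            using new_label_class[OF p v] by metis
          show ?thesis
          proof (rule ex1I[of _ w])
            show "w \<in> T \<and> (v, w) \<in> ?H" using w(1,2) inP[OF w(1)] h_nonzero by (simp add: T_def)
            show "w' = w" if "w' \<in> T \<and> (v, w') \<in> ?H" for w'
              using w(3)[of w'] that by (auto simp: T_def)
          qed
        qed
      qed simp
      \<comment> \<open>This includes kept leaves labelled \<open>b\<close>: the sum there counts
        preimages, and \<open>h b\<close> reproduces that number.\<close>
      also have "\<dots> = (\<Prod>v\<in>T. W' (gsubtree u v) (Leaf (h (leaf_label l v))))"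
      proof (intro prod.cong refl)
        fix v assume "v \<in> T"
        then have v: "v \<in> ?P" by (simp add: T_def)
        show "(\<Sum>g\<in>pre (gsubtree u v). W g (Leaf (leaf_label l v))) = W' (gsubtree u v) (Leaf (h (leaf_label l v)))"
          using u_sub[OF v] leaf_label_in[OF l_tree v] by (intro IH[symmetric])
      qed
      also have "\<dots> = (\<Prod>v\<in>T. W' (gsubtree u v) (Leaf (new_label l E v)))"
        by (intro prod.cong refl) (simp add: label_T)
      \<comment> \<open>The leaves outside \<open>T\<close> return as factors 1, now contributed by
        the fresh sink.\<close>
      also have "\<dots> = (\<Prod>v\<in>?P. W' (gsubtree u v) (Leaf (new_label l E v)))"
      proof (rule prod.mono_neutral_left)
        show "\<forall>v\<in>?P - T. W' (gsubtree u v) (Leaf (new_label l E v)) = 1"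
        proof
          fix v assume "v \<in> ?P - T"
          then have "v \<in> ?P" "new_label l E v = 0" by (auto simp: T_def)
          moreover have "alphabet new_grammar = \<Delta>" by (simp add: new_grammar_def)
          ultimately show "W' (gsubtree u v) (Leaf (new_label l E v)) = 1"
            using run_weight_sink[OF wtgc_new_grammar sink_new_grammar] u_sub(1) by simp
        qed
      qed (auto simp: T_def)
      also have "\<dots> = W' u ?l"
        using True by (simp add: run_weight_matches[OF wtgc_new_grammar, of u ?l] leaf_list_map_tree leaf_label_map_tree)
      finally show ?thesis using obeys by simp
    qed
    finally show ?thesis .
  qed
  finally show ?thesis .
qed

lemma target_new_production: "target (new_production p) = h (target p)"
  by (cases p) auto

text \<open>Undoing the merging of productions turns the left side into a sum over the productions
  of \<open>G\<close>. Each summand is a sum over preimages by \<open>sum_preimage_lhs\<close>, and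
  swapping the two sums gives the right side.\<close>

lemma run_weight_new_grammar:
  assumes "u \<in> gtrees \<Delta>" "q \<in> N"
  shows "W' u (Leaf (h q)) = (\<Sum>g\<in>pre u. W g (Leaf q))"
  using assms
proof (induction "size u" arbitrary: u q rule: less_induct)
  case less
  let ?P = "{p \<in> productions G. target p = q}"
  let ?X = "\<lambda>p'. if obeys (equalities p') u then W' u (fst p') else 0"
  have tq: "target p = q" if "p \<in> productions G" "h (target p) = h q" for p
  proof -
    have "target p \<in> N" using that(1) wtgc_production(3)[OF wtgc] by (cases p) auto
    then show ?thesis using inj that(2) less.prems(2) by (auto dest: inj_onD)
  qed
  have P': "{p' \<in> productions new_grammar. target p' = h q} = new_production ` ?P"
  proof (intro equalityI subsetI)
    fix p' assume "p' \<in> {p' \<in> productions new_grammar. target p' = h q}"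
    then have p': "p' \<in> productions new_grammar" "target p' = h q" by auto
    from p'(1) show "p' \<in> new_production ` ?P"
    proof (cases rule: production_cases)
      case (new l q0 E I)
      then have "q0 = q" using tq[OF new(1)] p'(2) by simp
      then show ?thesis using new by (intro image_eqI[of _ _ "(l, q0, E, I)"]) auto
    next
      case (sink \<delta>)
      then show ?thesis using p'(2) h_nonzero[of q] by simp
    qed
  qed (auto simp: target_new_production new_grammar_def)
  have wt': "wt new_grammar p' = (\<Sum>p\<in>{p \<in> ?P. new_production p = p'}. wt G p)"
    if "p' \<in> new_production ` ?P" for p'
  proof -
    have t: "target p' = h q" using that by (auto simp: target_new_production)
    \<comment> \<open>By injectivity of \<open>h\<close> on the nonterminals, all productions in the
      fibre have target \<open>q\<close>.\<close>
    have "{r \<in> productions G. new_production r = p'} = {p \<in> ?P. new_production p = p'}"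
      using t tq target_new_production by auto
    then show ?thesis using t by (simp add: new_grammar_def h_nonzero)
  qed
  have "W' u (Leaf (h q)) = (\<Sum>p'\<in>new_production ` ?P. wt new_grammar p' * ?X p')"
    unfolding run_weight_Leaf_obeys[OF wtgc_new_grammar positive_new_grammar classic_new_grammar] P' ..
  also have "\<dots> = (\<Sum>p'\<in>new_production ` ?P. \<Sum>p\<in>{p \<in> ?P. new_production p = p'}. wt G p * ?X (new_production p))"
    by (intro sum.cong refl) (simp add: wt' sum_distrib_right)
  \<comment> \<open>Fibres of \<open>new_production\<close> partition \<open>?P\<close>, and
    \<open>?X\<close> depends only on the image.\<close>
  also have "\<dots> = (\<Sum>p\<in>?P. wt G p * ?X (new_production p))"
    using finite_productions by (intro sum.image_gen[symmetric]) simp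
  also have "\<dots> = (\<Sum>p\<in>?P. wt G p * (\<Sum>g\<in>pre u. if obeys (equalities p) g then W g (fst p) else 0))"
  proof (intro sum.cong refl)
    fix p assume "p \<in> ?P"
    then obtain l E I where p: "p = (l, q, E, I)" "(l, q, E, I) \<in> productions G" by (cases p) auto
    have "(\<Sum>g\<in>pre u. if obeys E g then W g l else 0)
      = (if obeys E u then W' u (map_tree \<pi> (new_label l E) l) else 0)"
      using p(2) less.prems(1) less.hyps by (rule sum_preimage_lhs)
    then show "wt G p * ?X (new_production p)
      = wt G p * (\<Sum>g\<in>pre u. if obeys (equalities p) g then W g (fst p) else 0)"
      by (simp only: p(1) new_production.simps fst_conv snd_conv)
  qed
  also have "\<dots> = (\<Sum>g\<in>pre u. \<Sum>p\<in>?P. wt G p * (if obeys (equalities p) g then W g (fst p) else 0))"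
    unfolding sum_distrib_left by (rule sum.swap)
  also have "\<dots> = (\<Sum>g\<in>pre u. W g (Leaf q))"
    unfolding run_weight_Leaf_obeys[OF wtgc positive classic] ..
  finally show ?case .
qed

lemma generated_new_grammar:
  assumes "u \<in> gtrees \<Delta>"
  shows "generated new_grammar u = (\<Sum>g\<in>pre u. generated G g)"
proof -
  have fin: "finite N" using wtgc by (simp add: wtgc_def)
  have fw: "final_weight new_grammar (h q) = final_weight G q" if "q \<in> N" for q
    using that inj by (simp add: new_grammar_def h_nonzero)
  have "generated new_grammar u
      = (\<Sum>n\<in>insert 0 (h ` N). final_weight new_grammar n * W' u (Leaf n))"
    unfolding generated_run_weight[OF wtgc_new_grammar] by (simp add: new_grammar_def)
  \<comment> \<open>The fresh sink drops out because its final weight is 0.\<close>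
  also have "\<dots> = (\<Sum>n\<in>h ` N. final_weight new_grammar n * W' u (Leaf n))"
    using fin by (subst sum.insert) (auto simp: new_grammar_def h_nonzero)
  also have "\<dots> = (\<Sum>q\<in>N. final_weight new_grammar (h q) * W' u (Leaf (h q)))"
    by (simp add: sum.reindex[OF inj])
  also have "\<dots> = (\<Sum>q\<in>N. \<Sum>g\<in>pre u. final_weight G q * W g (Leaf q))"
    by (intro sum.cong refl) (simp add: run_weight_new_grammar[OF assms] fw sum_distrib_left)
  also have "\<dots> = (\<Sum>g\<in>pre u. generated G g)"
    unfolding generated_run_weight[OF wtgc] by (rule sum.swap)
  finally show ?thesis .
qed

end

theorem theorem4:
  fixes \<Sigma> :: "'f ranked_alphabet" and \<Delta> :: "'g ranked_alphabet" and \<pi> :: "'f \<Rightarrow> 'g"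
    and A :: "'f gtree \<Rightarrow> 's::{comm_semiring_0, comm_monoid_mult}"
    and G :: "('q, 'f, 's) wtgc"
  assumes "ranked_alphabet \<Sigma>" and "ranked_alphabet \<Delta>" and "relabeling \<Sigma> \<Delta> \<pi>"
    and "wtgc G" and "alphabet G = \<Sigma>"
    and "positive G" and "classic G" and "eq_restricted G"
    and "generates G A"
  shows "\<exists>G' :: (nat, 'g, 's) wtgc. wtgc G' \<and> alphabet G' = \<Delta> \<and>
    positive G' \<and> classic G' \<and> eq_restricted G' \<and>
    generates G' (relabel_language \<Sigma> \<pi> A)"
proof -
  obtain b where b: "sink G b" "\<forall>(l, q, E, I)\<in>productions G. class_condition l E b (nonterminals G)"
    using assms(8) unfolding eq_restricted_iff[OF assms(4,7)] by blast
  have "finite (nonterminals G)" using assms(4) by (simp add: wtgc_def)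
  then obtain f :: "'q \<Rightarrow> nat" where "inj_on f (nonterminals G)"
    using finite_imp_inj_to_nat_seg by blast
  \<comment> \<open>\<open>Suc\<close> shifts the coding away from 0.\<close>
  then interpret relabeled_grammar G \<Delta> \<pi> b "\<lambda>q. Suc (f q)"
    using assms b by unfold_locales (auto simp: inj_on_def)
  have "generates new_grammar (relabel_language \<Sigma> \<pi> A)"
    unfolding generates_def
  proof
    fix u assume "u \<in> gtrees (alphabet new_grammar)"
    then have "generated new_grammar u = (\<Sum>g\<in>pre u. generated G g)"
      by (intro generated_new_grammar) (simp add: new_grammar_def)
    also have "\<dots> = relabel_language \<Sigma> \<pi> A u"
      using assms(5,9) by (simp add: relabel_language_def preimage_def generates_def)
    finally show "relabel_language \<Sigma> \<pi> A u = generated new_grammar u" by simp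
  qed
  moreover have "alphabet new_grammar = \<Delta>" by (simp add: new_grammar_def)
  ultimately show ?thesis
    using wtgc_new_grammar positive_new_grammar classic_new_grammar eq_restricted_new_grammar by blast
qed

end
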